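(* Let $\chi$ be a representation $\pi_1(\mathbb{CP}^1\setminus\mathcal D)\to SL(2,\mathbb C)$, $\mathcal D=\{a_1,a_2,a_3\}$, which is the monodromy representation of some Riemann equation with singular points $\mathcal D$. Then $\chi$ can also be realized by the monodromy of a Riemann-Sturm-Liouville equation.
   Context: A Riemann equation with singular points $\mathcal D=\{a_1,a_2,a_3\}$ (three distinct points of $\mathbb{CP}^1$) is a second order linear differential equation $y''+b_1(z)y'+b_2(z)y=0$ on the Riemann sphere whose coefficients are holomorphic outside $\mathcal D$ (with every point of $\mathbb{CP}^1\setminus\mathcal D$, including $\infty$ in the local coordinate $1/z$ if $\infty\notin\mathcal D$, being an ordinary point) and which is Fuchsian at each $a_i$: in a local coordinate $t$ centred at $a_i$, the coefficient of the $(2-j)$-th derivative has a pole of order at most $j$, $j=1,2$. Monodromy: continuing a basis (row) $Y$ of the two-dimensional solution space near a base point along a loop $\gamma$ in $\mathbb{CP}^1\setminus\mathcal D$ gives another basis $Y^*$ with $Y=Y^*G_\gamma$. The map $[\gamma]\mapsto G_\gamma$ is the monodromy representation, defined up to simultaneous conjugation (choice of basis). An equation realizes $\chi$ if $\chi$ is its monodromy representation in some basis of solutions. A Riemann-Sturm-Liouville equation is a Riemann equation with no $y'$ term: $y''+q(z)y=0$. Such an equation necessarily has $\infty$ among its singular points; accordingly, "$\chi$ is realized by a Riemann-Sturm-Liouville equation" means that there is a Möbius transformation $m$ of $\mathbb{CP}^1$ with $\infty\in m(\mathcal D)$ and a Riemann-Sturm-Liouville equation with singular points $m(\mathcal D)$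 whose monodromy representation is $\chi$ under the identification $\pi_1(\mathbb{CP}^1\setminus\mathcal D)\cong\pi_1(\mathbb{CP}^1\setminus m(\mathcal D))$ induced by $m$. *)

theory Defs
  imports "HOL-Analysis.Analysis" "HOL-Algebra.Group"
begin

section \<open>The Riemann sphere\<close>

datatype cp1 = Fin complex | Infty

text \<open>The chart \<open>t = 1/z\<close> around the point at infinity, as a parametrisation.\<close>
definition inf_chart :: "complex \<Rightarrow> cp1" where
  "inf_chart t = (if t = 0 then Infty else Fin (1 / t))"

instantiation cp1 :: topological_space
begin

definition open_cp1 :: "cp1 set \<Rightarrow> bool" where
  "open_cp1 U \<longleftrightarrow> open (Fin -` U) \<and> open (inf_chart -` U)"

instance
proof
  show "open (UNIV :: cp1 set)"
    by (simp add: open_cp1_def)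
  show "open (S \<inter> T)" if "open S" "open T" for S T :: "cp1 set"
    using that by (auto simp: open_cp1_def)
  show "open (\<Union> K)" if "\<forall>S\<in>K. open S" for K :: "cp1 set set"
    using that by (auto simp: open_cp1_def vimage_Union)
qed

end

definition holomorphic_cp1 :: "(cp1 \<Rightarrow> complex) \<Rightarrow> cp1 set \<Rightarrow> bool" where
  "holomorphic_cp1 f U \<longleftrightarrow>
     (\<lambda>z. f (Fin z)) holomorphic_on (Fin -` U) \<and>
     (\<lambda>t. f (inf_chart t)) holomorphic_on (inf_chart -` U)"

definition moebius_map :: "complex \<Rightarrow> complex \<Rightarrow> complex \<Rightarrow> complex \<Rightarrow> cp1 \<Rightarrow> cp1" where
  "moebius_map a b c d w =
     (case w of
        Fin z \<Rightarrow> if c * z + d = 0 then Infty else Fin (moebius a b c d z)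
      | Infty \<Rightarrow> if c = 0 then Infty else Fin (a / c))"

definition moebius_transformation :: "(cp1 \<Rightarrow> cp1) \<Rightarrow> bool" where
  "moebius_transformation m \<longleftrightarrow> (\<exists>a b c d. a * d - b * c \<noteq> 0 \<and> m = moebius_map a b c d)"


section \<open>The fundamental group\<close>

definition loops :: "'a::topological_space set \<Rightarrow> 'a \<Rightarrow> (real \<Rightarrow> 'a) set" where
  "loops S x = {p. path p \<and> path_image p \<subseteq> S \<and> pathstart p = x \<and> pathfinish p = x}"

definition homotopy_class :: "'a::topological_space set \<Rightarrow> (real \<Rightarrow> 'a) \<Rightarrow> (real \<Rightarrow> 'a) set" where
  "homotopy_class S p = {q. homotopic_paths S p q}"

text \<open>The product of two classes is the class of the path that runs through the first factor
  first; the unions below are over representatives, all of which yield the same class.\<close>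
definition fundamental_group :: "'a::topological_space set \<Rightarrow> 'a \<Rightarrow> (real \<Rightarrow> 'a) set monoid" where
  "fundamental_group S x =
     \<lparr>carrier = homotopy_class S ` loops S x,
      mult = (\<lambda>A B. \<Union>p\<in>A. \<Union>q\<in>B. homotopy_class S (p +++ q)),
      one = homotopy_class S (\<lambda>_. x)\<rparr>"

definition induced_map ::
    "('a::topological_space \<Rightarrow> 'b::topological_space) \<Rightarrow> 'b set \<Rightarrow> (real \<Rightarrow> 'a) set \<Rightarrow> (real \<Rightarrow> 'b) set"
  where "induced_map f T A = (\<Union>p\<in>A. homotopy_class T (f \<circ> p))"

definition SL2 :: "(complex^2^2) monoid" where
  "SL2 = \<lparr>carrier = {A. det A = 1}, mult = (**), one = mat 1\<rparr>"


section \<open>Riemann equations\<close>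

text \<open>Order \<open>0\<close> means a removable singularity.\<close>
definition pole_order_at_most :: "(complex \<Rightarrow> complex) \<Rightarrow> complex \<Rightarrow> nat \<Rightarrow> bool" where
  "pole_order_at_most f a k \<longleftrightarrow>
     (\<exists>g. g analytic_on {a} \<and> (\<forall>\<^sub>F z in at a. (z - a) ^ k * f z = g z))"

text \<open>With \<open>t = 1/z\<close> one has \<open>d/dz = - t\<^sup>2 d/dt\<close> and \<open>d\<^sup>2/dz\<^sup>2 = t\<^sup>4 d\<^sup>2/dt\<^sup>2 + 2 t\<^sup>3 d/dt\<close>, so that
  \<open>y'' + b\<^sub>1 y' + b\<^sub>2 y = 0\<close>, divided by \<open>t\<^sup>4\<close>, has the following coefficients in the coordinate \<open>t\<close>.\<close>
definition inf_coeff1 :: "(complex \<Rightarrow> complex) \<Rightarrow> complex \<Rightarrow> complex" where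
  "inf_coeff1 b1 t = 2 / t - b1 (1 / t) / t ^ 2"

definition inf_coeff2 :: "(complex \<Rightarrow> complex) \<Rightarrow> complex \<Rightarrow> complex" where
  "inf_coeff2 b2 t = b2 (1 / t) / t ^ 4"

text \<open>The values of the coefficients at the singular points are irrelevant.\<close>
definition riemann_equation :: "cp1 set \<Rightarrow> (complex \<Rightarrow> complex) \<Rightarrow> (complex \<Rightarrow> complex) \<Rightarrow> bool" where
  "riemann_equation D b1 b2 \<longleftrightarrow>
     card D = 3 \<and>
     b1 holomorphic_on {z. Fin z \<notin> D} \<and> b2 holomorphic_on {z. Fin z \<notin> D} \<and>
     (\<forall>a. Fin a \<in> D \<longrightarrow> pole_order_at_most b1 a 1 \<and> pole_order_at_most b2 a 2) \<and>
     (if Infty \<in> D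
      then pole_order_at_most (inf_coeff1 b1) 0 1 \<and> pole_order_at_most (inf_coeff2 b2) 0 2
      else pole_order_at_most (inf_coeff1 b1) 0 0 \<and> pole_order_at_most (inf_coeff2 b2) 0 0)"

definition riemann_sturm_liouville_equation :: "cp1 set \<Rightarrow> (complex \<Rightarrow> complex) \<Rightarrow> bool" where
  "riemann_sturm_liouville_equation D q \<longleftrightarrow> riemann_equation D (\<lambda>_. 0) q"


section \<open>Monodromy\<close>

text \<open>If \<open>Infty \<in> U\<close> is an ordinary point, the equation in the coordinate \<open>t = 1/z\<close> holds at
  \<open>t = 0\<close> by continuity, since \<open>f\<close> is required to be holomorphic there.\<close>
definition solution_on ::
    "(complex \<Rightarrow> complex) \<Rightarrow> (complex \<Rightarrow> complex) \<Rightarrow> cp1 set \<Rightarrow> (cp1 \<Rightarrow> complex) \<Rightarrow> bool" where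
  "solution_on b1 b2 U f \<longleftrightarrow>
     holomorphic_cp1 f U \<and>
     (\<forall>z. Fin z \<in> U \<longrightarrow>
        deriv (deriv (\<lambda>z. f (Fin z))) z + b1 z * deriv (\<lambda>z. f (Fin z)) z + b2 z * f (Fin z) = 0)"

definition local_solution ::
    "(complex \<Rightarrow> complex) \<Rightarrow> (complex \<Rightarrow> complex) \<Rightarrow> cp1 \<Rightarrow> (cp1 \<Rightarrow> complex) \<Rightarrow> bool" where
  "local_solution b1 b2 x f \<longleftrightarrow> (\<exists>U. open U \<and> x \<in> U \<and> solution_on b1 b2 U f)"

text \<open>A row of two local solutions that is a basis of the space of germs of solutions at \<open>x\<close>.\<close>
definition solution_basis ::
    "(complex \<Rightarrow> complex) \<Rightarrow> (complex \<Rightarrow> complex) \<Rightarrow> cp1 \<Rightarrow> (cp1 \<Rightarrow> complex^2) \<Rightarrow> bool" where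
  "solution_basis b1 b2 x Y \<longleftrightarrow>
     (\<forall>i. local_solution b1 b2 x (\<lambda>z. Y z $ i)) \<and>
     (\<forall>f. local_solution b1 b2 x f \<longrightarrow>
        (\<exists>!c::complex^2. \<forall>\<^sub>F z in nhds x. f z = (\<Sum>i\<in>UNIV. c $ i * Y z $ i)))"

text \<open>\<open>F t\<close> represents a row of germs at the point \<open>\<gamma> t\<close>; germs at nearby parameters are those of
  the same row of functions.\<close>
definition continuation_along ::
    "(complex \<Rightarrow> complex) \<Rightarrow> (complex \<Rightarrow> complex) \<Rightarrow> (real \<Rightarrow> cp1) \<Rightarrow> (real \<Rightarrow> cp1 \<Rightarrow> complex^2) \<Rightarrow> bool"
  where
  "continuation_along b1 b2 \<gamma> F \<longleftrightarrow>
     (\<forall>t\<in>{0..1}.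
        (\<forall>i. local_solution b1 b2 (\<gamma> t) (\<lambda>z. F t z $ i)) \<and>
        (\<forall>\<^sub>F s in at t within {0..1}. \<forall>\<^sub>F z in nhds (\<gamma> s). F s z = F t z))"

text \<open>\<open>Y = Y\<^sup>* G\<close> as germs at the base point of the loop \<open>\<gamma>\<close>, where \<open>Y\<^sup>*\<close> is the continuation of \<open>Y\<close>
  along \<open>\<gamma>\<close>.\<close>
definition monodromy_matrix ::
    "(complex \<Rightarrow> complex) \<Rightarrow> (complex \<Rightarrow> complex) \<Rightarrow> (cp1 \<Rightarrow> complex^2) \<Rightarrow> (real \<Rightarrow> cp1) \<Rightarrow> complex^2^2 \<Rightarrow> bool"
  where
  "monodromy_matrix b1 b2 Y \<gamma> G \<longleftrightarrow>
     (\<exists>F. continuation_along b1 b2 \<gamma> F \<and>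
        (\<forall>\<^sub>F z in nhds (pathstart \<gamma>). F 0 z = Y z) \<and>
        (\<forall>\<^sub>F z in nhds (pathfinish \<gamma>). Y z = F 1 z v* G))"

definition monodromy_representation ::
    "cp1 set \<Rightarrow> (complex \<Rightarrow> complex) \<Rightarrow> (complex \<Rightarrow> complex) \<Rightarrow> cp1 \<Rightarrow> ((real \<Rightarrow> cp1) set \<Rightarrow> complex^2^2) \<Rightarrow> bool"
  where
  "monodromy_representation D b1 b2 x \<rho> \<longleftrightarrow>
     (\<exists>Y. solution_basis b1 b2 x Y \<and>
        (\<forall>\<gamma>\<in>loops (- D) x. monodromy_matrix b1 b2 Y \<gamma> (\<rho> (homotopy_class (- D) \<gamma>))))"

end

theory Submission
  imports Defs "HOL-Complex_Analysis.Complex_Analysis"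
begin

text \<open>After a Moebius transformation one singular point is infinity, and Liouville's theorem gives
  \<open>b\<^sub>1 = r/(z - a) + s/(z - b)\<close>. Continuing the Wronskian around \<open>a\<close> and \<open>b\<close> and using
  \<open>det \<chi> = 1\<close> shows that \<open>r\<close> and \<open>s\<close> are integers. Substitutions \<open>u = p y + q y'\<close> with rational
  \<open>p\<close>, \<open>q\<close> and invertible Wronskian matrix outside the singular points do not change the monodromy.
  Multiplication by \<open>(z - a)\<^sup>k (z - b)\<^sup>l\<close> changes \<open>r\<close> and \<open>s\<close> by \<open>- 2 k\<close> and \<open>- 2 l\<close>, so if both are
  even, \<open>b\<^sub>1\<close> can be removed. Otherwise a contiguity operator \<open>u = y' - l y\<close>, which moves one exponent
  at each of two singular points by one, makes both of them even. Of the four choices of a pair of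
  exponents at these points at least one gives an injective operator, unless the equation is
  (up to a factor as above) solved by \<open>1\<close> and a logarithm; such equations are treated by explicit substitutions.\<close>


section \<open>Germs on the Riemann sphere\<close>

text \<open>Cancelling b1 outright takes the factor (z - a)^(r/2) (z - b)^(s/2), which for odd r
  multiplies the monodromy around a by -1. So parity is the obstacle, and integer powers leave it
  unchanged. The residue at infinity in the coordinate 1/z is 2 - r - s, hence the number of odd
  residues is zero or two. Up to exchanging a and b there remain the residues (1, 1), odd at a and
  b, and (0, 1), odd at b and infinity. A contiguity operator is applied at the odd pair. For u = y'
  - l y the determinant d = l' + l^2 + b1 l + b2 is rational. Taking the residues of l from
  exponents at the pair cancels its leading terms there; what is left is a constant times powers of
  1/(z - a) and 1/(z - b). Such a d has no zero in the plane, so no apparent singularity is created.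
  The new first coefficient is b1 - d'/d, which explains how r and s move. The constant K depends on
  the exponents through an even part and a linear part. Reversing both signs isolates the linear
  part, so if all four K vanish, both exponents are 0 and all parameters of b2 vanish; this leaves
  exactly the logarithmic equations.\<close>

lemma continuous_on_cp1I:
  fixes m :: "cp1 \<Rightarrow> cp1"
  assumes "\<And>U. open U \<Longrightarrow> open {z. m (Fin z) \<in> U}"
    and "\<And>U. open U \<Longrightarrow> open {t. m (inf_chart t) \<in> U}"
  shows "continuous_on UNIV m"
  using assms by (auto simp: continuous_on_open_vimage open_cp1_def vimage_def)

lemma open_vimage_Fin: "open U \<Longrightarrow> open (Fin -` U)"
  by (simp add: open_cp1_def)

lemma open_vimage_inf_chart: "open U \<Longrightarrow> open (inf_chart -` U)"
  by (simp add: open_cp1_def)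

lemma open_image_Fin:
  assumes "open V"
  shows "open (Fin ` V)"
proof -
  have "inf_chart -` (Fin ` V) = (- {0}) \<inter> (\<lambda>t. 1 / t) -` V"
    by (auto simp: inf_chart_def split: if_splits)
  moreover have "open ((- {0}) \<inter> (\<lambda>t::complex. 1 / t) -` V)"
    by (intro continuous_open_preimage assms continuous_intros) auto
  moreover have "Fin -` (Fin ` V) = V"
    by auto
  ultimately show ?thesis
    using assms by (simp add: open_cp1_def)
qed

lemma continuous_on_Fin: "continuous_on S Fin"
  by (rule continuous_on_subset[of UNIV]) (auto simp: continuous_on_open_vimage open_vimage_Fin)

text \<open>\<open>Fin\<close> is continuous and open, so germs at a finite point of the sphere are
  germs of functions of z, and local work can be done in the plane.\<close>

lemma nhds_Fin: "nhds (Fin z) = filtermap Fin (nhds z)"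
proof (rule filtermap_nhds_open_map[symmetric])
  show "isCont Fin z"
    using continuous_on_Fin[of UNIV] by (simp add: continuous_on_eq_continuous_at)
qed (rule open_image_Fin)

lemma eventually_nhds_Fin: "(\<forall>\<^sub>F w in nhds (Fin z). P w) \<longleftrightarrow> (\<forall>\<^sub>F w in nhds z. P (Fin w))"
  by (simp add: nhds_Fin eventually_filtermap)

text \<open>The plane version of \<open>solution_on\<close>. At finite points it loses nothing: off
  t = 0 the chart at infinity is z = 1/t, so holomorphy in t follows from holomorphy in z.\<close>

definition ode_on ::
  "(complex \<Rightarrow> complex) \<Rightarrow> (complex \<Rightarrow> complex) \<Rightarrow> complex set \<Rightarrow> (complex \<Rightarrow> complex) \<Rightarrow> bool" where
  "ode_on b1 b2 V f \<longleftrightarrow>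
     f holomorphic_on V \<and> (\<forall>z\<in>V. deriv (deriv f) z + b1 z * deriv f z + b2 z * f z = 0)"

lemma solution_on_image_Fin:
  assumes "ode_on b1 b2 V (\<lambda>z. f (Fin z))"
  shows "solution_on b1 b2 (Fin ` V) f"
proof -
  have "(\<lambda>t. f (inf_chart t)) holomorphic_on (inf_chart -` (Fin ` V))"
  proof (rule holomorphic_transform)
    show "((\<lambda>z. f (Fin z)) \<circ> (\<lambda>t. 1 / t)) holomorphic_on (inf_chart -` (Fin ` V))"
      by (rule holomorphic_on_compose_gen[where t = V])
        (use assms in \<open>auto simp: inf_chart_def ode_on_def split: if_splits intro!: holomorphic_intros\<close>)
  qed (auto simp: inf_chart_def)
  with assms show ?thesis
    by (auto simp: solution_on_def holomorphic_cp1_def ode_on_def vimage_def)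
qed

lemma local_solution_Fin:
  "local_solution b1 b2 (Fin z) f \<longleftrightarrow> (\<exists>V. open V \<and> z \<in> V \<and> ode_on b1 b2 V (\<lambda>z. f (Fin z)))"
proof
  assume "local_solution b1 b2 (Fin z) f"
  then obtain U where "open U" "Fin z \<in> U" "solution_on b1 b2 U f"
    by (auto simp: local_solution_def)
  then show "\<exists>V. open V \<and> z \<in> V \<and> ode_on b1 b2 V (\<lambda>z. f (Fin z))"
    by (intro exI[of _ "Fin -` U"])
      (auto simp: open_vimage_Fin ode_on_def solution_on_def holomorphic_cp1_def)
next
  assume "\<exists>V. open V \<and> z \<in> V \<and> ode_on b1 b2 V (\<lambda>z. f (Fin z))"
  then show "local_solution b1 b2 (Fin z) f"
    unfolding local_solution_def by (blast intro: open_image_Fin solution_on_image_Fin)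
qed

lemma ode_on_subset: "ode_on b1 b2 V f \<Longrightarrow> W \<subseteq> V \<Longrightarrow> ode_on b1 b2 W f"
  unfolding ode_on_def by (auto intro: holomorphic_on_subset)

text \<open>Trades iterated \<open>deriv\<close> for explicit derivatives; as V is open,
  \<open>deriv f\<close> and \<open>f1\<close> agree near each point and hence have the same
  derivative.\<close>

lemma ode_onI:
  assumes "open V"
    and "\<And>z. z \<in> V \<Longrightarrow> (f has_field_derivative f1 z) (at z)"
    and "\<And>z. z \<in> V \<Longrightarrow> (f1 has_field_derivative f2 z) (at z)"
    and "\<And>z. z \<in> V \<Longrightarrow> f2 z + b1 z * f1 z + b2 z * f z = 0"
  shows "ode_on b1 b2 V f"
proof -
  have "f holomorphic_on V"
    using assms(1,2) by (auto simp: holomorphic_on_open)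
  moreover have "deriv (deriv f) z = f2 z" if "z \<in> V" for z
  proof -
    have "\<forall>\<^sub>F w in nhds z. deriv f w = f1 w"
      using assms(1) that by (auto simp: eventually_nhds intro!: exI[of _ V] DERIV_imp_deriv assms(2))
    then have "deriv (deriv f) z = deriv f1 z"
      by (rule deriv_cong_ev) auto
    also have "\<dots> = f2 z"
      using that by (intro DERIV_imp_deriv assms(3))
    finally show ?thesis .
  qed
  ultimately show ?thesis
    using assms(4) DERIV_imp_deriv[OF assms(2)] by (auto simp: ode_on_def)
qed

lemma ode_onD:
  assumes "ode_on b1 b2 V f" "open V" "z \<in> V"
  shows "(f has_field_derivative deriv f z) (at z)"
    and "(deriv f has_field_derivative (- b1 z * deriv f z - b2 z * f z)) (at z)"
proof -
  have f: "f holomorphic_on V"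
    using assms(1) by (simp add: ode_on_def)
  then show "(f has_field_derivative deriv f z) (at z)"
    using assms by (blast intro: holomorphic_derivI)
  have "(deriv f has_field_derivative deriv (deriv f) z) (at z)"
    using assms f by (blast intro: holomorphic_derivI holomorphic_deriv)
  moreover have "deriv (deriv f) z = - b1 z * deriv f z - b2 z * f z"
  proof -
    have "deriv (deriv f) z + b1 z * deriv f z + b2 z * f z = 0"
      using assms(1,3) by (simp add: ode_on_def)
    then show ?thesis
      by algebra
  qed
  ultimately show "(deriv f has_field_derivative (- b1 z * deriv f z - b2 z * f z)) (at z)"
    by simp
qed

lemma deriv_linear_combination:
  assumes "f field_differentiable at z" "g field_differentiable at z"
  shows "deriv (\<lambda>z. c * f z + d * g z) z = c * deriv f z + d * deriv g z"
  using assms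
  by (intro DERIV_imp_deriv derivative_eq_intros refl | auto simp: DERIV_deriv_iff_field_differentiable)+

lemma solution_on_linear_combination:
  assumes "open U" "solution_on b1 b2 U f" "solution_on b1 b2 U g"
  shows "solution_on b1 b2 U (\<lambda>z. c * f z + d * g z)"
proof -
  have "ode_on b1 b2 (Fin -` U) (\<lambda>z. f (Fin z))" "ode_on b1 b2 (Fin -` U) (\<lambda>z. g (Fin z))"
    using assms by (auto simp: ode_on_def solution_on_def holomorphic_cp1_def)
  note D = ode_onD[OF this(1) open_vimage_Fin[OF assms(1)]] ode_onD[OF this(2) open_vimage_Fin[OF assms(1)]]
  have "ode_on b1 b2 (Fin -` U) (\<lambda>z. c * f (Fin z) + d * g (Fin z))"
    by (rule ode_onI[where ?f1.0 = "\<lambda>z. c * deriv (\<lambda>z. f (Fin z)) z + d * deriv (\<lambda>z. g (Fin z)) z"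
          and ?f2.0 = "\<lambda>z. c * (- b1 z * deriv (\<lambda>z. f (Fin z)) z - b2 z * f (Fin z)) +
                       d * (- b1 z * deriv (\<lambda>z. g (Fin z)) z - b2 z * g (Fin z))"])
      (rule open_vimage_Fin[OF assms(1)], (rule DERIV_add DERIV_cmult D | assumption)+, simp add: algebra_simps)
  moreover have "(\<lambda>t. c * f (inf_chart t) + d * g (inf_chart t)) holomorphic_on (inf_chart -` U)"
    using assms by (auto simp: solution_on_def holomorphic_cp1_def intro!: holomorphic_intros)
  ultimately show ?thesis
    by (auto simp: ode_on_def solution_on_def holomorphic_cp1_def)
qed

lemma solution_on_subset: "solution_on b1 b2 U f \<Longrightarrow> W \<subseteq> U \<Longrightarrow> solution_on b1 b2 W f"
  unfolding solution_on_def holomorphic_cp1_def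
  by (auto intro: holomorphic_on_subset)

lemma local_solution_linear_combination:
  assumes "local_solution b1 b2 x f" "local_solution b1 b2 x g"
  shows "local_solution b1 b2 x (\<lambda>z. c * f z + d * g z)"
proof -
  obtain U W where "open U" "x \<in> U" "solution_on b1 b2 U f" "open W" "x \<in> W" "solution_on b1 b2 W g"
    using assms by (auto simp: local_solution_def)
  then show ?thesis
    unfolding local_solution_def
    by (intro exI[of _ "U \<inter> W"] conjI solution_on_linear_combination)
      (auto intro: solution_on_subset)
qed


section \<open>Transfer of the monodromy representation\<close>

text \<open>An isomorphism between the local systems of solutions of two equations, covering m. T
  acts on total functions; \<open>germ\<close> makes it descend to germs, and the other assumptions
  make it a linear bijection of solution germs at each nonsingular point. That is all the monodromy
  sees.\<close>

locale solution_transfer =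
  fixes D :: "cp1 set" and b1 b2 c1 c2 :: "complex \<Rightarrow> complex"
    and m :: "cp1 \<Rightarrow> cp1" and T :: "(cp1 \<Rightarrow> complex) \<Rightarrow> cp1 \<Rightarrow> complex"
  assumes sol: "x \<notin> D \<Longrightarrow> local_solution b1 b2 x f \<Longrightarrow> local_solution c1 c2 (m x) (T f)"
    and germ: "x \<notin> D \<Longrightarrow> \<forall>\<^sub>F z in nhds x. f z = g z \<Longrightarrow> \<forall>\<^sub>F w in nhds (m x). T f w = T g w"
    and lin: "x \<notin> D \<Longrightarrow> local_solution b1 b2 x f \<Longrightarrow> local_solution b1 b2 x g \<Longrightarrow>
           \<forall>\<^sub>F w in nhds (m x). T (\<lambda>z. c * f z + d * g z) w = c * T f w + d * T g w"
    and inj: "x \<notin> D \<Longrightarrow> local_solution b1 b2 x f \<Longrightarrow> \<forall>\<^sub>F w in nhds (m x). T f w = 0 \<Longrightarrow>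
           \<forall>\<^sub>F z in nhds x. f z = 0"
    and surj: "x \<notin> D \<Longrightarrow> local_solution c1 c2 (m x) h \<Longrightarrow>
           \<exists>f. local_solution b1 b2 x f \<and> (\<forall>\<^sub>F w in nhds (m x). T f w = h w)"
begin

text \<open>T is applied to every row of the continuation. Neighbouring germs stay equal because T
  respects germs, and the relation between the first and last row keeps its matrix because each
  entry of \<open>F 1 z v* G\<close> is a linear combination with constant coefficients.\<close>

lemma monodromy_matrix_transfer:
  assumes \<gamma>: "path_image \<gamma> \<subseteq> - D"
    and "monodromy_matrix b1 b2 Y \<gamma> G"
  shows "monodromy_matrix c1 c2 (\<lambda>w. \<chi> i. T (\<lambda>z. Y z $ i) w) (m \<circ> \<gamma>) G"
proof -
  obtain F where F: "continuation_along b1 b2 \<gamma> F"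
    and F0: "\<forall>\<^sub>F z in nhds (pathstart \<gamma>). F 0 z = Y z"
    and F1: "\<forall>\<^sub>F z in nhds (pathfinish \<gamma>). Y z = F 1 z v* G"
    using assms(2) by (auto simp: monodromy_matrix_def)
  define F' where "F' t = (\<lambda>w. \<chi> i. T (\<lambda>z. F t z $ i) w)" for t
  have notin: "\<gamma> t \<notin> D" if "t \<in> {0..1}" for t
    using \<gamma> that by (auto simp: path_image_def image_subset_iff)
  have germs: "\<forall>\<^sub>F w in nhds (m x). (\<chi> i. T (\<lambda>z. A z $ i) w) = (\<chi> i. T (\<lambda>z. B z $ i) w)"
    if "x \<notin> D" "\<forall>\<^sub>F z in nhds x. A z = B z" for x and A B :: "cp1 \<Rightarrow> complex^2"
  proof -
    have "\<forall>\<^sub>F w in nhds (m x). T (\<lambda>z. A z $ i) w = T (\<lambda>z. B z $ i) w" for i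
      using that by (intro germ) (auto elim: eventually_mono)
    then have "\<forall>\<^sub>F w in nhds (m x). \<forall>i. T (\<lambda>z. A z $ i) w = T (\<lambda>z. B z $ i) w"
      by (simp add: eventually_all_finite)
    then show ?thesis
      by eventually_elim (simp add: vec_eq_iff)
  qed
  have "continuation_along c1 c2 (m \<circ> \<gamma>) F'"
    unfolding continuation_along_def
  proof (intro ballI conjI allI)
    fix t :: real and i :: 2
    assume t: "t \<in> {0..1}"
    show "local_solution c1 c2 ((m \<circ> \<gamma>) t) (\<lambda>z. F' t z $ i)"
      using F t notin[OF t] by (auto simp: F'_def continuation_along_def intro!: sol)
    have "\<forall>\<^sub>F s in at t within {0..1}. \<forall>\<^sub>F z in nhds (\<gamma> s). F s z = F t z"
      using F t by (auto simp: continuation_along_def)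
    moreover have "\<forall>\<^sub>F s in at t within {0..1}. s \<in> {0..1}"
      by (simp add: eventually_at_filter)
    ultimately show "\<forall>\<^sub>F s in at t within {0..1}. \<forall>\<^sub>F z in nhds ((m \<circ> \<gamma>) s). F' s z = F' t z"
    proof eventually_elim
      case (elim s)
      then show ?case
        using germs[of "\<gamma> s" "F s" "F t"] notin by (auto simp: F'_def)
    qed
  qed
  moreover have "\<forall>\<^sub>F w in nhds (pathstart (m \<circ> \<gamma>)). F' 0 w = (\<chi> i. T (\<lambda>z. Y z $ i) w)"
    using germs[OF _ F0] notin[of 0] by (simp add: F'_def pathstart_def)
  moreover have "\<forall>\<^sub>F w in nhds (pathfinish (m \<circ> \<gamma>)). (\<chi> i. T (\<lambda>z. Y z $ i) w) = F' 1 w v* G"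
  proof -
    have 1: "\<gamma> 1 \<notin> D"
      using notin by auto
    have ls: "local_solution b1 b2 (\<gamma> 1) (\<lambda>z. F 1 z $ i)" for i
      using F by (auto simp: continuation_along_def)
    have "\<forall>\<^sub>F w in nhds (m (\<gamma> 1)). T (\<lambda>z. Y z $ i) w = (F' 1 w v* G) $ i" for i
    proof -
      have "\<forall>\<^sub>F z in nhds (\<gamma> 1). Y z $ i = G $ 1 $ i * F 1 z $ 1 + G $ 2 $ i * F 1 z $ 2"
        using F1 by (auto simp: pathfinish_def vector_matrix_mult_def sum_2 mult.commute elim!: eventually_mono)
      from germ[OF 1 this] lin[OF 1 ls ls, of "G $ 1 $ i" 1 "G $ 2 $ i" 2] show ?thesis
        by eventually_elim (simp add: F'_def vector_matrix_mult_def sum_2 mult.commute)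
    qed
    then have "\<forall>\<^sub>F w in nhds (m (\<gamma> 1)). \<forall>i. T (\<lambda>z. Y z $ i) w = (F' 1 w v* G) $ i"
      by (simp add: eventually_all_finite)
    then show ?thesis
      by (auto simp: pathfinish_def vec_eq_iff elim!: eventually_mono)
  qed
  ultimately show ?thesis
    unfolding monodromy_matrix_def by blast
qed

text \<open>Existence of coordinates comes from \<open>surj\<close>, uniqueness from
  \<open>inj\<close>.\<close>

lemma solution_basis_transfer:
  assumes x: "x \<notin> D" and Y: "solution_basis b1 b2 x Y"
  shows "solution_basis c1 c2 (m x) (\<lambda>w. \<chi> i. T (\<lambda>z. Y z $ i) w)"
  unfolding solution_basis_def
proof (intro conjI allI impI)
  have ls: "local_solution b1 b2 x (\<lambda>z. Y z $ i)" for i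
    using Y by (auto simp: solution_basis_def)
  show "local_solution c1 c2 (m x) (\<lambda>w. (\<chi> i. T (\<lambda>z. Y z $ i) w) $ i)" for i
    using sol[OF x ls] by simp
  have TY: "\<forall>\<^sub>F w in nhds (m x). T (\<lambda>z. \<Sum>i\<in>UNIV. c $ i * Y z $ i) w
      = (\<Sum>i\<in>UNIV. c $ i * (\<chi> i. T (\<lambda>z. Y z $ i) w) $ i)" for c :: "complex^2"
    using lin[OF x ls ls, of "c $ 1" 1 "c $ 2" 2] by (simp add: sum_2)
  fix g
  assume "local_solution c1 c2 (m x) g"
  then obtain f where f: "local_solution b1 b2 x f" and Tf: "\<forall>\<^sub>F w in nhds (m x). T f w = g w"
    using surj[OF x] by blast
  obtain c :: "complex^2" where c: "\<forall>\<^sub>F z in nhds x. f z = (\<Sum>i\<in>UNIV. c $ i * Y z $ i)"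
    using Y f unfolding solution_basis_def by blast
  show "\<exists>!c::complex^2. \<forall>\<^sub>F w in nhds (m x). g w = (\<Sum>i\<in>UNIV. c $ i * (\<chi> i. T (\<lambda>z. Y z $ i) w) $ i)"
  proof (rule ex1I[of _ c])
    show "\<forall>\<^sub>F w in nhds (m x). g w = (\<Sum>i\<in>UNIV. c $ i * (\<chi> i. T (\<lambda>z. Y z $ i) w) $ i)"
      using Tf germ[OF x c] TY[of c] by eventually_elim simp
  next
    fix c' :: "complex^2"
    assume c': "\<forall>\<^sub>F w in nhds (m x). g w = (\<Sum>i\<in>UNIV. c' $ i * (\<chi> i. T (\<lambda>z. Y z $ i) w) $ i)"
    \<comment> \<open>The difference of two coordinate rows yields a solution that T kills; once it
      vanishes, c' represents f as well as c does.\<close>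
    have "\<forall>\<^sub>F z in nhds x. (c' $ 1 - c $ 1) * Y z $ 1 + (c' $ 2 - c $ 2) * Y z $ 2 = 0"
    proof (rule inj[OF x])
      show "local_solution b1 b2 x (\<lambda>z. (c' $ 1 - c $ 1) * Y z $ 1 + (c' $ 2 - c $ 2) * Y z $ 2)"
        by (intro local_solution_linear_combination ls)
      show "\<forall>\<^sub>F w in nhds (m x). T (\<lambda>z. (c' $ 1 - c $ 1) * Y z $ 1 + (c' $ 2 - c $ 2) * Y z $ 2) w = 0"
        using Tf germ[OF x c] TY[of c] c' lin[OF x ls ls, of "c' $ 1 - c $ 1" 1 "c' $ 2 - c $ 2" 2]
        by eventually_elim (simp add: sum_2 algebra_simps)
    qed
    then have "\<forall>\<^sub>F z in nhds x. f z = (\<Sum>i\<in>UNIV. c' $ i * Y z $ i)"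
      using c by eventually_elim (simp add: sum_2 algebra_simps)
    then show "c' = c"
      using c Y f unfolding solution_basis_def by blast
  qed
qed

end


section \<open>Gauge transformations\<close>

text \<open>The system \<open>u = p y + q y'\<close>, \<open>u' = p2 y + q2 y'\<close> relates the two equations; the
  hypotheses below are what differentiating both lines and comparing coefficients gives.\<close>
locale gauge =
  fixes S :: "complex set" and b1 b2 c1 c2 p q p2 q2 :: "complex \<Rightarrow> complex"
  assumes p: "z \<in> S \<Longrightarrow> (p has_field_derivative p2 z + q z * b2 z) (at z)"
    and q: "z \<in> S \<Longrightarrow> (q has_field_derivative q2 z - p z + q z * b1 z) (at z)"
    and p2: "z \<in> S \<Longrightarrow> (p2 has_field_derivative q2 z * b2 z - c1 z * p2 z - c2 z * p z) (at z)"
    and q2: "z \<in> S \<Longrightarrow> (q2 has_field_derivative q2 z * b1 z - p2 z - c1 z * q2 z - c2 z * q z) (at z)"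
    and det: "z \<in> S \<Longrightarrow> p z * q2 z - q z * p2 z \<noteq> 0"
begin

lemma forward_deriv:
  assumes "open V" "V \<subseteq> S" "ode_on b1 b2 V f" "z \<in> V"
  shows "((\<lambda>z. p z * f z + q z * deriv f z) has_field_derivative p2 z * f z + q2 z * deriv f z) (at z)"
proof -
  note D = ode_onD[OF assms(3,1,4)]
  have "z \<in> S" using assms by auto
  then show ?thesis
    by - (rule derivative_eq_intros p q D refl | assumption | simp add: algebra_simps)+
qed

lemma forward:
  assumes "open V" "V \<subseteq> S" "ode_on b1 b2 V f"
  shows "ode_on c1 c2 V (\<lambda>z. p z * f z + q z * deriv f z)"
proof (rule ode_onI[OF assms(1) forward_deriv[OF assms]])
  fix z assume z: "z \<in> V"
  note D = ode_onD[OF assms(3,1) z]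
  have "z \<in> S" using assms z by auto
  show "((\<lambda>z. p2 z * f z + q2 z * deriv f z) has_field_derivative
      (q2 z * b2 z - c1 z * p2 z - c2 z * p z) * f z + p2 z * deriv f z +
      (q2 z * b1 z - p2 z - c1 z * q2 z - c2 z * q z) * deriv f z +
      q2 z * (- b1 z * deriv f z - b2 z * f z)) (at z)"
    using \<open>z \<in> S\<close> by - (rule derivative_eq_intros p2 q2 D refl | assumption | simp add: algebra_simps)+
qed (simp_all add: algebra_simps)

text \<open>Cramer's rule for the system (u, u') in terms of (y, y') suggests y = N / \<Delta> and
  y' = M / \<Delta>. These are consistent because N' = (b1 - c1) N + M while \<Delta>' = (b1 - c1)
  \<Delta>, so the common factor drops out of the quotient.\<close>

lemma backward:
  assumes "open V" "V \<subseteq> S" "ode_on c1 c2 V u"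
  defines "y \<equiv> \<lambda>z. (q2 z * u z - q z * deriv u z) / (p z * q2 z - q z * p2 z)"
  shows "ode_on b1 b2 V y" and "z \<in> V \<Longrightarrow> p z * y z + q z * deriv y z = u z"
proof -
  define N where "N z = q2 z * u z - q z * deriv u z" for z
  define M where "M z = p z * deriv u z - p2 z * u z" for z
  define \<Delta> where "\<Delta> z = p z * q2 z - q z * p2 z" for z
  have N': "(N has_field_derivative (b1 z - c1 z) * N z + M z) (at z)"
    and M': "(M has_field_derivative - b2 z * N z - c1 z * M z) (at z)"
    and \<Delta>': "(\<Delta> has_field_derivative (b1 z - c1 z) * \<Delta> z) (at z)"
    and \<Delta>: "\<Delta> z \<noteq> 0" if z: "z \<in> V" for z
  proof -
    note D = ode_onD[OF assms(3,1) z]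
    have "z \<in> S" using assms z by auto
    note P = p[OF this] q[OF this] p2[OF this] q2[OF this]
    show "(N has_field_derivative (b1 z - c1 z) * N z + M z) (at z)"
      unfolding N_def M_def by (rule derivative_eq_intros P D refl | simp add: algebra_simps)+
    show "(M has_field_derivative - b2 z * N z - c1 z * M z) (at z)"
      unfolding N_def M_def by (rule derivative_eq_intros P D refl | simp add: algebra_simps)+
    show "(\<Delta> has_field_derivative (b1 z - c1 z) * \<Delta> z) (at z)"
      unfolding \<Delta>_def by (rule derivative_eq_intros P refl | simp add: algebra_simps)+
    show "\<Delta> z \<noteq> 0"
      using det[OF \<open>z \<in> S\<close>] by (simp add: \<Delta>_def)
  qed
  have y: "y = (\<lambda>z. N z / \<Delta> z)"
    by (simp add: y_def N_def \<Delta>_def fun_eq_iff)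
  have y': "(y has_field_derivative M z / \<Delta> z) (at z)" if "z \<in> V" for z
    unfolding y
    by (rule DERIV_cong[OF DERIV_divide[OF N'[OF that] \<Delta>'[OF that] \<Delta>[OF that]]])
      (simp add: \<Delta>[OF that] field_simps)
  show "ode_on b1 b2 V y"
  proof (rule ode_onI[OF assms(1) y'])
    show "((\<lambda>z. M z / \<Delta> z) has_field_derivative (- b2 z * N z - b1 z * M z) / \<Delta> z) (at z)"
      if "z \<in> V" for z
      by (rule DERIV_cong[OF DERIV_divide[OF M'[OF that] \<Delta>'[OF that] \<Delta>[OF that]]])
        (simp add: \<Delta>[OF that] field_simps)
    show "(- b2 z * N z - b1 z * M z) / \<Delta> z + b1 z * (M z / \<Delta> z) + b2 z * y z = 0" if "z \<in> V" for z
      by (simp add: y \<Delta>[OF that] field_simps)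
  qed
  show "p z * y z + q z * deriv y z = u z" if "z \<in> V"
  proof -
    have "p z * N z + q z * M z = \<Delta> z * u z"
      by (simp add: N_def M_def \<Delta>_def algebra_simps)
    moreover have "p z * y z + q z * deriv y z = (p z * N z + q z * M z) / \<Delta> z"
      unfolding DERIV_imp_deriv[OF y'[OF that]] by (simp add: y add_divide_distrib)
    ultimately show ?thesis
      using \<Delta>[OF that] by simp
  qed
qed

text \<open>Infinity is singular wherever this operator acts on solutions; the value 0 there is a
  placeholder.\<close>

definition T :: "(cp1 \<Rightarrow> complex) \<Rightarrow> cp1 \<Rightarrow> complex" where
  "T f w = (case w of Fin z \<Rightarrow> p z * f (Fin z) + q z * deriv (\<lambda>z. f (Fin z)) z | Infty \<Rightarrow> 0)"

lemma T_Fin [simp]: "T f (Fin z) = p z * f (Fin z) + q z * deriv (\<lambda>z. f (Fin z)) z"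
  by (simp add: T_def)

end

lemma eventually_nhds_deriv:
  assumes "\<forall>\<^sub>F w in nhds z. f w = g w"
  shows "\<forall>\<^sub>F w in nhds z. deriv f w = deriv g w"
proof -
  have "\<forall>\<^sub>F w in nhds z. \<forall>\<^sub>F v in nhds w. f v = g v"
    using assms by (simp add: eventually_eventually)
  then show ?thesis
    by eventually_elim (auto intro: deriv_cong_ev)
qed

text \<open>Every nonsingular point is finite here, so the gauge gives a
  \<open>solution_transfer\<close> over the identity map: \<open>forward\<close> maps solutions to
  solutions, \<open>backward\<close> inverts, and the coefficients are single valued off a and
  b.\<close>

lemma monodromy_representation_gauge:
  assumes "gauge (- {a, b}) b1 b2 c1 c2 p q p2 q2"
    and "x \<notin> {Fin a, Fin b, Infty}"
    and "monodromy_representation {Fin a, Fin b, Infty} b1 b2 x \<rho>"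
  shows "monodromy_representation {Fin a, Fin b, Infty} c1 c2 x \<rho>"
proof -
  interpret gauge "- {a, b}" b1 b2 c1 c2 p q p2 q2 by fact
  let ?D = "{Fin a, Fin b, Infty}"
  have fin: "\<exists>z. x = Fin z \<and> z \<in> - {a, b}" if "x \<notin> ?D" for x
    using that by (cases x) auto
  have nbhd: "\<exists>V. open V \<and> z \<in> V \<and> V \<subseteq> - {a, b} \<and> ode_on b1 b2 V (\<lambda>z. f (Fin z))"
    if H: "local_solution b1 b2 (Fin z) f" "z \<in> - {a, b}" for z f b1 b2
  proof -
    obtain V where V: "open V" "z \<in> V" "ode_on b1 b2 V (\<lambda>z. f (Fin z))"
      using H(1) unfolding local_solution_Fin by blast
    have "open (V \<inter> - {a, b})"
      using V(1) by (intro open_Int) auto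
    with V(2) H(2) ode_on_subset[OF V(3), of "V \<inter> - {a, b}"] show ?thesis
      by blast
  qed
  have sol: "local_solution c1 c2 (id x) (T f)" if H: "x \<notin> ?D" "local_solution b1 b2 x f" for x f
  proof -
    obtain z where z: "x = Fin z" "z \<in> - {a, b}" using fin[OF H(1)] by blast
    with H nbhd[of b1 b2 z f] show ?thesis
      by (auto simp: local_solution_Fin intro: forward)
  qed
  have germ: "\<forall>\<^sub>F w in nhds (id x). T f w = T g w"
    if H: "x \<notin> ?D" "\<forall>\<^sub>F z in nhds x. f z = g z" for x f g
  proof -
    obtain z where z: "x = Fin z" using fin[OF H(1)] by blast
    have "\<forall>\<^sub>F z in nhds z. f (Fin z) = g (Fin z)"
      using H(2) by (simp add: z eventually_nhds_Fin)
    with eventually_nhds_deriv[OF this] show ?thesis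
      unfolding z id_apply eventually_nhds_Fin by eventually_elim simp
  qed
  have lin: "\<forall>\<^sub>F w in nhds (id x). T (\<lambda>z. c * f z + d * g z) w = c * T f w + d * T g w"
    if H: "x \<notin> ?D" "local_solution b1 b2 x f" "local_solution b1 b2 x g" for x f g c d
  proof -
    obtain z where z: "x = Fin z" "z \<in> - {a, b}" using fin[OF H(1)] by blast
    obtain V W where V: "open V" "z \<in> V" "ode_on b1 b2 V (\<lambda>z. f (Fin z))"
      and W: "open W" "z \<in> W" "ode_on b1 b2 W (\<lambda>z. g (Fin z))"
      using H z by (auto simp: local_solution_Fin)
    have "\<forall>\<^sub>F w in nhds z. w \<in> V \<inter> W"
      using V W by (intro eventually_nhds_in_open) auto
    then show ?thesis
      unfolding z id_apply eventually_nhds_Fin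
    proof eventually_elim
      case (elim w)
      then have "deriv (\<lambda>z. c * f (Fin z) + d * g (Fin z)) w
          = c * deriv (\<lambda>z. f (Fin z)) w + d * deriv (\<lambda>z. g (Fin z)) w"
        using ode_onD(1)[OF V(3,1)] ode_onD(1)[OF W(3,1)]
        by (intro deriv_linear_combination) (auto simp: field_differentiable_def)
      then show ?case
        by (simp add: algebra_simps)
    qed
  qed
  have inj: "\<forall>\<^sub>F z in nhds x. f z = 0"
    if H: "x \<notin> ?D" "local_solution b1 b2 x f" "\<forall>\<^sub>F w in nhds (id x). T f w = 0" for x f
  proof -
    obtain z where z: "x = Fin z" "z \<in> - {a, b}" using fin[OF H(1)] by blast
    obtain V where V: "open V" "z \<in> V" "V \<subseteq> - {a, b}" "ode_on b1 b2 V (\<lambda>z. f (Fin z))"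
      using nbhd[of b1 b2 z f] H z by auto
    have u: "\<forall>\<^sub>F w in nhds z. p w * f (Fin w) + q w * deriv (\<lambda>z. f (Fin z)) w = 0"
      using H(3) by (simp add: z eventually_nhds_Fin)
    have V': "\<forall>\<^sub>F w in nhds z. w \<in> V"
      using V by (intro eventually_nhds_in_open)
    show ?thesis
      unfolding z eventually_nhds_Fin
      using u eventually_nhds_deriv[OF u] V'
    proof eventually_elim
      case (elim w)
      \<comment> \<open>If u vanishes near z, so does u'. The two homogeneous linear equations for
        (f, f') have nonzero determinant, hence f = 0.\<close>
      then have "p2 w * f (Fin w) + q2 w * deriv (\<lambda>z. f (Fin z)) w = 0"
        using DERIV_imp_deriv[OF forward_deriv[OF V(1,3,4), of w]] by simp
      then have "(p w * q2 w - q w * p2 w) * f (Fin w) = 0"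
        using elim by algebra
      then show ?case
        using det[of w] elim V(3) by auto
    qed
  qed
  have surj: "\<exists>f. local_solution b1 b2 x f \<and> (\<forall>\<^sub>F w in nhds (id x). T f w = g w)"
    if H: "x \<notin> ?D" "local_solution c1 c2 (id x) g" for x g
  proof -
    obtain z where z: "x = Fin z" "z \<in> - {a, b}" using fin[OF H(1)] by blast
    obtain V where V: "open V" "z \<in> V" "V \<subseteq> - {a, b}" "ode_on c1 c2 V (\<lambda>z. g (Fin z))"
      using nbhd[of c1 c2 z g] H z by auto
    define y where "y w = (q2 w * g (Fin w) - q w * deriv (\<lambda>z. g (Fin z)) w) /
        (p w * q2 w - q w * p2 w)" for w
    have y: "ode_on b1 b2 V y" "\<And>w. w \<in> V \<Longrightarrow> p w * y w + q w * deriv y w = g (Fin w)"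
      using backward[OF V(1,3,4)] by (simp_all add: y_def[abs_def])
    define f where "f w = (case w of Fin z \<Rightarrow> y z | Infty \<Rightarrow> 0)" for w
    have f: "(\<lambda>z. f (Fin z)) = y" by (simp add: f_def)
    have "\<forall>\<^sub>F w in nhds z. w \<in> V"
      using V by (intro eventually_nhds_in_open)
    then have "\<forall>\<^sub>F w in nhds (id x). T f w = g w"
      unfolding z id_apply eventually_nhds_Fin
      by eventually_elim (simp add: f y(2), simp add: f_def y(2))
    moreover have "local_solution b1 b2 x f"
      unfolding z local_solution_Fin f using V y(1) by blast
    ultimately show ?thesis by blast
  qed
  interpret solution_transfer ?D b1 b2 c1 c2 id T
    by unfold_locales (fact sol germ lin inj surj)+
  obtain Y where Y: "solution_basis b1 b2 x Y"
    and mono: "\<And>\<gamma>. \<gamma> \<in> loops (- ?D) x \<Longrightarrow> monodromy_matrix b1 b2 Y \<gamma> (\<rho> (homotopy_class (- ?D) \<gamma>))"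
    using assms(3) by (auto simp: monodromy_representation_def)
  have "solution_basis c1 c2 (id x) (\<lambda>w. \<chi> i. T (\<lambda>z. Y z $ i) w)"
    by (rule solution_basis_transfer[OF assms(2) Y])
  moreover have "monodromy_matrix c1 c2 (\<lambda>w. \<chi> i. T (\<lambda>z. Y z $ i) w) (id \<circ> \<gamma>)
      (\<rho> (homotopy_class (- ?D) \<gamma>))" if "\<gamma> \<in> loops (- ?D) x" for \<gamma>
    by (rule monodromy_matrix_transfer[OF _ mono[OF that]])
      (use that in \<open>auto simp: loops_def\<close>)
  ultimately show ?thesis
    by (auto simp: monodromy_representation_def)
qed


section \<open>Normal forms with singular points \<open>a\<close>, \<open>b\<close> and infinity\<close>

text \<open>The reciprocals 1/(z - a) and 1/(z - b) are kept as atoms, so that most gauge conditions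
  become polynomial identities in them.\<close>

definition coeff1 :: "complex \<Rightarrow> complex \<Rightarrow> complex \<Rightarrow> complex \<Rightarrow> complex \<Rightarrow> complex" where
  "coeff1 a b r s z = r * (1 / (z - a)) + s * (1 / (z - b))"

text \<open>The general form compatible with decay of order z^(-2) at infinity. With
  \<open>coeff1 a b r s\<close>, the exponents \<mu> at a solve \<mu>^2 + (r - 1) \<mu> + \<alpha> =
  0, those at b the same with s and \<beta>, and the growth exponents k of z^k at infinity solve k^2
  + (r + s - 1) k + \<alpha> + \<beta> + \<delta> = 0.\<close>

definition coeff2 :: "complex \<Rightarrow> complex \<Rightarrow> complex \<Rightarrow> complex \<Rightarrow> complex \<Rightarrow> complex \<Rightarrow> complex" where
  "coeff2 a b \<alpha> \<beta> \<delta> z =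
     \<alpha> * (1 / (z - a))\<^sup>2 + \<beta> * (1 / (z - b))\<^sup>2 + \<delta> * (1 / (z - a)) * (1 / (z - b))"

lemma DERIV_pole:
  fixes z :: complex
  assumes "z \<noteq> a"
  shows "((\<lambda>z. 1 / (z - a)) has_field_derivative - (1 / (z - a))\<^sup>2) (at z)"
  using assms by (auto intro!: derivative_eq_intros simp: power2_eq_square divide_simps)

text \<open>For u = \<phi> y with logarithmic derivative h of \<phi>, the new coefficients are b1 -
  2 h and b2 - b1 h - h' + h^2, and the determinant is \<phi>^2. Integer exponents keep \<phi>
  single valued.\<close>

lemma gauge_scalar:
  fixes a b r s \<alpha> \<beta> \<delta> :: complex and k l :: int
  defines "h \<equiv> \<lambda>z. of_int k * (1 / (z - a)) + of_int l * (1 / (z - b))"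
    and "\<phi> \<equiv> \<lambda>z. (z - a) powi k * (z - b) powi l"
  shows "gauge (- {a, b}) (coeff1 a b r s) (coeff2 a b \<alpha> \<beta> \<delta>)
    (coeff1 a b (r - 2 * of_int k) (s - 2 * of_int l))
    (coeff2 a b (\<alpha> - r * of_int k + of_int k + (of_int k)\<^sup>2) (\<beta> - s * of_int l + of_int l + (of_int l)\<^sup>2)
      (\<delta> - r * of_int l - s * of_int k + 2 * of_int k * of_int l))
    \<phi> (\<lambda>_. 0) (\<lambda>z. \<phi> z * h z) \<phi>"
proof
  fix z assume z: "z \<in> - {a, b}"
  then have ne: "z - a \<noteq> 0" "z - b \<noteq> 0" by auto
  have \<phi>': "(\<phi> has_field_derivative \<phi> z * h z) (at z)"
    unfolding \<phi>_def h_def using ne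
    by (auto intro!: derivative_eq_intros simp: power_int_diff field_simps)
  have X: "((\<lambda>z. 1 / (z - a)) has_field_derivative - (1 / (z - a))\<^sup>2) (at z)"
    "((\<lambda>z. 1 / (z - b)) has_field_derivative - (1 / (z - b))\<^sup>2) (at z)"
    using z by (auto intro: DERIV_pole)
  show "(\<phi> has_field_derivative \<phi> z * h z + 0 * coeff2 a b \<alpha> \<beta> \<delta> z) (at z)"
    using \<phi>' by simp
  show "((\<lambda>_. 0) has_field_derivative \<phi> z - \<phi> z + 0 * coeff1 a b r s z) (at z)"
    by simp
  show "((\<lambda>z. \<phi> z * h z) has_field_derivative \<phi> z * coeff2 a b \<alpha> \<beta> \<delta> z -
      coeff1 a b (r - 2 * of_int k) (s - 2 * of_int l) z * (\<phi> z * h z) -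
      coeff2 a b (\<alpha> - r * of_int k + of_int k + (of_int k)\<^sup>2) (\<beta> - s * of_int l + of_int l + (of_int l)\<^sup>2)
        (\<delta> - r * of_int l - s * of_int k + 2 * of_int k * of_int l) z * \<phi> z) (at z)"
    unfolding h_def
    by (rule derivative_eq_intros \<phi>' X refl)+
      (simp add: h_def coeff1_def coeff2_def power2_eq_square algebra_simps del: times_divide_eq_left times_divide_eq_right)
  show "(\<phi> has_field_derivative \<phi> z * coeff1 a b r s z - \<phi> z * h z -
      coeff1 a b (r - 2 * of_int k) (s - 2 * of_int l) z * \<phi> z -
      coeff2 a b (\<alpha> - r * of_int k + of_int k + (of_int k)\<^sup>2) (\<beta> - s * of_int l + of_int l + (of_int l)\<^sup>2)
        (\<delta> - r * of_int l - s * of_int k + 2 * of_int k * of_int l) z * 0) (at z)"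
    by (rule DERIV_cong[OF \<phi>'])
      (simp add: h_def coeff1_def algebra_simps del: times_divide_eq_left times_divide_eq_right)
  show "\<phi> z * \<phi> z - 0 * (\<phi> z * h z) \<noteq> 0"
    using ne by (simp add: \<phi>_def)
qed

text \<open>The contiguity operator \<open>u = y' - l y\<close> with \<open>l = \<mu>/(z - a) + \<nu>/(z - b)\<close>. Its determinant is
  \<open>l' + l\<^sup>2 + b\<^sub>1 l + b\<^sub>2\<close>, which has the form \<open>K/((z - a)(z - b))\<close> when \<open>\<mu>\<close> and \<open>\<nu>\<close> are
  exponents at \<open>a\<close> and \<open>b\<close>.\<close>
lemma gauge_shift_finite:
  fixes a b r s \<alpha> \<beta> \<delta> \<mu> \<nu> K :: complex
  assumes "K \<noteq> 0" "\<alpha> = \<mu> - \<mu>\<^sup>2 - r * \<mu>" "\<beta> = \<nu> - \<nu>\<^sup>2 - s * \<nu>" "\<delta> = K - 2 * \<mu> * \<nu> - r * \<nu> - s * \<mu>"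
  defines "l \<equiv> coeff1 a b \<mu> \<nu>" and "e \<equiv> coeff1 a b (r + \<mu>) (s + \<nu>)"
  shows "gauge (- {a, b}) (coeff1 a b r s) (coeff2 a b \<alpha> \<beta> \<delta>)
    (coeff1 a b (r + 1) (s + 1))
    (coeff2 a b (- \<mu> * (r + \<mu>)) (- \<nu> * (s + \<nu>)) (r + \<mu> + s + \<nu> + K - \<mu> * (s + \<nu>) - \<nu> * (r + \<mu>)))
    (\<lambda>z. - l z) (\<lambda>_. 1) (\<lambda>z. l z * e z - K * (1 / (z - a)) * (1 / (z - b))) (\<lambda>z. - e z)"
proof
  fix z assume z: "z \<in> - {a, b}"
  define X Y where "X = 1 / (z - a)" and "Y = 1 / (z - b)"
  have X: "((\<lambda>z. 1 / (z - a)) has_field_derivative - X\<^sup>2) (at z)"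
    "((\<lambda>z. 1 / (z - b)) has_field_derivative - Y\<^sup>2) (at z)"
    using z by (auto simp: X_def Y_def intro: DERIV_pole)
  note D = derivative_eq_intros X refl
  note S = X_def[symmetric] Y_def[symmetric] coeff1_def coeff2_def l_def e_def assms(2-4)
    power2_eq_square algebra_simps
  \<comment> \<open>Differentiating u gives u' = - (b2 + l') y - (b1 + l) y'. Here e = b1 + l, and
    the determinant formula turns - (b2 + l') into l e - K/((z - a)(z - b)). The logarithmic
    derivative of that determinant is -1/(z - a) - 1/(z - b), so r and s each grow by 1.\<close>
  show "((\<lambda>z. - l z) has_field_derivative
      l z * e z - K * (1 / (z - a)) * (1 / (z - b)) + 1 * coeff2 a b \<alpha> \<beta> \<delta> z) (at z)"
    unfolding l_def coeff1_def[abs_def] by (rule D)+ (simp add: S)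
  show "((\<lambda>_. 1) has_field_derivative - e z - - l z + 1 * coeff1 a b r s z) (at z)"
    by (rule D)+ (simp add: S)
  show "((\<lambda>z. l z * e z - K * (1 / (z - a)) * (1 / (z - b))) has_field_derivative
      - e z * coeff2 a b \<alpha> \<beta> \<delta> z -
      coeff1 a b (r + 1) (s + 1) z * (l z * e z - K * (1 / (z - a)) * (1 / (z - b))) -
      coeff2 a b (- \<mu> * (r + \<mu>)) (- \<nu> * (s + \<nu>)) (r + \<mu> + s + \<nu> + K - \<mu> * (s + \<nu>) - \<nu> * (r + \<mu>)) z * - l z) (at z)"
    unfolding l_def e_def coeff1_def[abs_def] by (rule D)+ (simp add: S)
  show "((\<lambda>z. - e z) has_field_derivative
      - e z * coeff1 a b r s z - (l z * e z - K * (1 / (z - a)) * (1 / (z - b))) -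
      coeff1 a b (r + 1) (s + 1) z * - e z -
      coeff2 a b (- \<mu> * (r + \<mu>)) (- \<nu> * (s + \<nu>)) (r + \<mu> + s + \<nu> + K - \<mu> * (s + \<nu>) - \<nu> * (r + \<mu>)) z * 1) (at z)"
    unfolding l_def e_def coeff1_def[abs_def] by (rule D)+ (simp add: S)
  show "- l z * - e z - 1 * (l z * e z - K * (1 / (z - a)) * (1 / (z - b))) \<noteq> 0"
    using z \<open>K \<noteq> 0\<close> by auto
qed

text \<open>Here \<open>\<nu>\<close> is an exponent at \<open>b\<close> and \<open>- \<mu> - \<nu>\<close> one at infinity, so that the determinant is
  \<open>K (a - b)/((z - a)\<^sup>2 (z - b))\<close>.\<close>
lemma gauge_shift_infinity:
  fixes a b r s \<alpha> \<beta> \<delta> \<mu> \<nu> K :: complex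
  assumes "K \<noteq> 0" "a \<noteq> b" "\<alpha> = \<mu> - \<mu>\<^sup>2 - r * \<mu> + K" "\<beta> = \<nu> - \<nu>\<^sup>2 - s * \<nu>"
    "\<delta> = - K - 2 * \<mu> * \<nu> - r * \<nu> - s * \<mu>"
  defines "l \<equiv> coeff1 a b \<mu> \<nu>" and "e \<equiv> coeff1 a b (r + \<mu>) (s + \<nu>)"
    and "\<kappa> \<equiv> coeff2 a b K 0 (- K)"
  shows "gauge (- {a, b}) (coeff1 a b r s) (coeff2 a b \<alpha> \<beta> \<delta>)
    (coeff1 a b (r + 2) (s + 1))
    (coeff2 a b (r + \<mu> + K - \<mu> * (r + \<mu>)) (- \<nu> * (s + \<nu>))
      (r + \<mu> + 2 * (s + \<nu>) - K - \<mu> * (s + \<nu>) - \<nu> * (r + \<mu>)))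
    (\<lambda>z. - l z) (\<lambda>_. 1) (\<lambda>z. l z * e z - \<kappa> z) (\<lambda>z. - e z)"
proof
  fix z assume z: "z \<in> - {a, b}"
  define X Y where "X = 1 / (z - a)" and "Y = 1 / (z - b)"
  have X: "((\<lambda>z. 1 / (z - a)) has_field_derivative - X\<^sup>2) (at z)"
    "((\<lambda>z. 1 / (z - b)) has_field_derivative - Y\<^sup>2) (at z)"
    using z by (auto simp: X_def Y_def intro: DERIV_pole)
  note D = derivative_eq_intros X refl
  note S = X_def[symmetric] Y_def[symmetric] coeff1_def coeff2_def l_def e_def \<kappa>_def assms(3-5)
    power2_eq_square algebra_simps
  note U = l_def e_def \<kappa>_def coeff1_def[abs_def] coeff2_def[abs_def] power2_eq_square
  let ?c2 = "coeff2 a b (r + \<mu> + K - \<mu> * (r + \<mu>)) (- \<nu> * (s + \<nu>))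
      (r + \<mu> + 2 * (s + \<nu>) - K - \<mu> * (s + \<nu>) - \<nu> * (r + \<mu>))"
  \<comment> \<open>Again u' = (l e - \<kappa>) y - e y', now with determinant \<kappa>. Its double
    pole at a and simple pole at b are why r grows by 2 and s by 1.\<close>
  show "((\<lambda>z. - l z) has_field_derivative l z * e z - \<kappa> z + 1 * coeff2 a b \<alpha> \<beta> \<delta> z) (at z)"
    unfolding l_def coeff1_def[abs_def] by (rule D)+ (simp add: S)
  show "((\<lambda>_. 1) has_field_derivative - e z - - l z + 1 * coeff1 a b r s z) (at z)"
    by (rule D)+ (simp add: S)
  show "((\<lambda>z. l z * e z - \<kappa> z) has_field_derivative - e z * coeff2 a b \<alpha> \<beta> \<delta> z -
      coeff1 a b (r + 2) (s + 1) z * (l z * e z - \<kappa> z) - ?c2 z * - l z) (at z)"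
    unfolding U by (rule D)+ (simp add: S)
  show "((\<lambda>z. - e z) has_field_derivative - e z * coeff1 a b r s z - (l z * e z - \<kappa> z) -
      coeff1 a b (r + 2) (s + 1) z * - e z - ?c2 z * 1) (at z)"
    unfolding l_def e_def coeff1_def[abs_def] by (rule D)+ (simp add: S)
  have "\<kappa> z = K * X * (X - Y)"
    by (simp add: S)
  moreover have "X \<noteq> 0" "X - Y \<noteq> 0"
    using z \<open>a \<noteq> b\<close> by (auto simp: X_def Y_def)
  ultimately show "- l z * - e z - 1 * (l z * e z - \<kappa> z) \<noteq> 0"
    using \<open>K \<noteq> 0\<close> by simp
qed

text \<open>The equation with solutions \<open>1\<close> and \<open>log ((z - b)/(z - a))\<close>, on which no contiguity operator
  is injective; the new equation has the solution \<open>(z - a)(z - b)\<close>.\<close>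
lemma gauge_log_finite:
  assumes "a \<noteq> b"
  shows "gauge (- {a, b}) (coeff1 a b 1 1) (coeff2 a b 0 0 0) (coeff1 a b 0 0) (coeff2 a b 0 0 (- 2))
    (\<lambda>z. (z - a) * (z - b)) (\<lambda>z. (z - a) * (z - b) * (2 * z - a - b) / 2)
    (\<lambda>z. 2 * z - a - b) (\<lambda>z. 2 * (z - a) * (z - b))"
proof
  fix z assume "z \<in> - {a, b}"
  then have ne: "z - a \<noteq> 0" "z - b \<noteq> 0" and ne': "z \<noteq> a" "z \<noteq> b" by auto
  note S = coeff1_def coeff2_def ne ne' divide_simps
  \<comment> \<open>The operator sends 1 to p = (z - a)(z - b). The factor q is chosen so that the
    logarithm L goes to p L + (b - a)(2 z - a - b)/2, a second solution of the new equation.\<close>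
  show "((\<lambda>z. (z - a) * (z - b)) has_field_derivative (2 * z - a - b +
      (z - a) * (z - b) * (2 * z - a - b) / 2 * coeff2 a b 0 0 0 z)) (at z)"
    by (rule derivative_eq_intros refl)+ (simp add: S)
  show "((\<lambda>z. (z - a) * (z - b) * (2 * z - a - b) / 2) has_field_derivative
      2 * (z - a) * (z - b) - (z - a) * (z - b) + (z - a) * (z - b) * (2 * z - a - b) / 2 * coeff1 a b 1 1 z) (at z)"
    by (rule derivative_eq_intros refl)+ (simp_all add: S, algebra?)
  show "((\<lambda>z. 2 * z - a - b) has_field_derivative 2 * (z - a) * (z - b) * coeff2 a b 0 0 0 z -
      coeff1 a b 0 0 z * (2 * z - a - b) - coeff2 a b 0 0 (- 2) z * ((z - a) * (z - b))) (at z)"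
    by (rule derivative_eq_intros refl)+ (simp_all add: S)
  show "((\<lambda>z. 2 * (z - a) * (z - b)) has_field_derivative 2 * (z - a) * (z - b) * coeff1 a b 1 1 z -
      (2 * z - a - b) - coeff1 a b 0 0 z * (2 * (z - a) * (z - b)) -
      coeff2 a b 0 0 (- 2) z * ((z - a) * (z - b) * (2 * z - a - b) / 2)) (at z)"
    by (rule derivative_eq_intros refl)+ (simp_all add: S, algebra?)
  \<comment> \<open>The discriminant identity (2 z - a - b)^2 - 4 (z - a)(z - b) = (a - b)^2 leaves
    a determinant without zeros off a and b.\<close>
  have "(z - a) * (z - b) * (2 * (z - a) * (z - b)) -
      (z - a) * (z - b) * (2 * z - a - b) / 2 * (2 * z - a - b) = - (z - a) * (z - b) * (a - b)\<^sup>2 / 2"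
    by (simp add: field_simps power2_eq_square)
  also have "\<dots> \<noteq> 0"
    using ne assms by simp
  finally show "(z - a) * (z - b) * (2 * (z - a) * (z - b)) -
      (z - a) * (z - b) * (2 * z - a - b) / 2 * (2 * z - a - b) \<noteq> 0" .
qed

text \<open>The equation with solutions \<open>1\<close> and \<open>log (z - b)\<close>; the new one has the solution
  \<open>(z - b)/(z - a)\<close>.\<close>
lemma gauge_log_infinity:
  fixes a b :: complex
  assumes "a \<noteq> b"
  defines "d \<equiv> b - a"
  shows "gauge (- {a, b}) (coeff1 a b 0 1) (coeff2 a b 0 0 0) (coeff1 a b 0 0) (coeff2 a b (- 2) 0 2)
    (\<lambda>z. (z - b) / (z - a)) (\<lambda>z. (z - b) * (z - b - d) / (2 * d))
    (\<lambda>z. d / (z - a)\<^sup>2) (\<lambda>z. (z - b) / (z - a) + (z - b) / (2 * d))"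
proof
  fix z assume "z \<in> - {a, b}"
  then have ne: "z - a \<noteq> 0" "z - b \<noteq> 0" "d \<noteq> 0" using assms by auto
  have a: "a = b - d" by (simp add: d_def)
  \<comment> \<open>In terms of w and d the only denominators are w, w + d and d, all
    nonzero.\<close>
  define w where "w = z - b"
  have z: "z = b + w" by (simp add: w_def)
  have ne': "w + d \<noteq> 0" "w \<noteq> 0" using ne by (auto simp: z a)
  note S = coeff1_def coeff2_def a z ne' ne(3) field_simps power2_eq_square
  \<comment> \<open>The operator sends 1 to p = (z - b)/(z - a) and log (z - b) to p log (z - b) +
    (z - b - d)/(2 d). The point a, ordinary before, acquires the exponents -1 and 2.\<close>
  show "((\<lambda>z. (z - b) / (z - a)) has_field_derivative d / (z - a)\<^sup>2 +
      (z - b) * (z - b - d) / (2 * d) * coeff2 a b 0 0 0 z) (at z)"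
    by (rule derivative_eq_intros refl ne)+ (simp add: S)
  show "((\<lambda>z. (z - b) * (z - b - d) / (2 * d)) has_field_derivative
      (z - b) / (z - a) + (z - b) / (2 * d) - (z - b) / (z - a) +
      (z - b) * (z - b - d) / (2 * d) * coeff1 a b 0 1 z) (at z)"
  proof (rule DERIV_cong)
    show "((\<lambda>z. (z - b) * (z - b - d) / (2 * d)) has_field_derivative (2 * z - 2 * b - d) / (2 * d)) (at z)"
      using ne by - (rule derivative_eq_intros refl | simp add: field_simps)+
    show "(2 * z - 2 * b - d) / (2 * d) = (z - b) / (z - a) + (z - b) / (2 * d) - (z - b) / (z - a) +
        (z - b) * (z - b - d) / (2 * d) * coeff1 a b 0 1 z"
      using ne ne' by (simp add: coeff1_def z divide_simps)
  qed
  show "((\<lambda>z. d / (z - a)\<^sup>2) has_field_derivative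
      ((z - b) / (z - a) + (z - b) / (2 * d)) * coeff2 a b 0 0 0 z -
      coeff1 a b 0 0 z * (d / (z - a)\<^sup>2) - coeff2 a b (- 2) 0 2 z * ((z - b) / (z - a))) (at z)"
  proof (rule DERIV_cong)
    show "((\<lambda>z. d / (z - a)\<^sup>2) has_field_derivative - 2 * d / (z - a) ^ 3) (at z)"
      using ne by (auto intro!: derivative_eq_intros simp: power2_eq_square power3_eq_cube divide_simps)
    show "- 2 * d / (z - a) ^ 3 = ((z - b) / (z - a) + (z - b) / (2 * d)) * coeff2 a b 0 0 0 z -
        coeff1 a b 0 0 z * (d / (z - a)\<^sup>2) - coeff2 a b (- 2) 0 2 z * ((z - b) / (z - a))"
      using ne' by (simp add: coeff1_def coeff2_def a z power2_eq_square power3_eq_cube divide_simps)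
  qed
  show "((\<lambda>z. (z - b) / (z - a) + (z - b) / (2 * d)) has_field_derivative
      ((z - b) / (z - a) + (z - b) / (2 * d)) * coeff1 a b 0 1 z - d / (z - a)\<^sup>2 -
      coeff1 a b 0 0 z * ((z - b) / (z - a) + (z - b) / (2 * d)) -
      coeff2 a b (- 2) 0 2 z * ((z - b) * (z - b - d) / (2 * d))) (at z)"
  proof (rule DERIV_cong)
    show "((\<lambda>z. (z - b) / (z - a) + (z - b) / (2 * d)) has_field_derivative d / (z - a)\<^sup>2 + 1 / (2 * d)) (at z)"
      using ne by - (rule derivative_eq_intros refl | simp add: S)+
    show "d / (z - a)\<^sup>2 + 1 / (2 * d) =
      ((z - b) / (z - a) + (z - b) / (2 * d)) * coeff1 a b 0 1 z - d / (z - a)\<^sup>2 -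
      coeff1 a b 0 0 z * ((z - b) / (z - a) + (z - b) / (2 * d)) -
      coeff2 a b (- 2) 0 2 z * ((z - b) * (z - b - d) / (2 * d))"
      using ne ne' by (simp add: coeff1_def coeff2_def a z divide_simps power2_eq_square) algebra
  qed
  have "(z - b) / (z - a) * ((z - b) / (z - a) + (z - b) / (2 * d)) -
      (z - b) * (z - b - d) / (2 * d) * (d / (z - a)\<^sup>2) = (z - b) / (2 * d)"
    using ne ne' by (simp add: a z divide_simps power2_eq_square) algebra
  then show "(z - b) / (z - a) * ((z - b) / (z - a) + (z - b) / (2 * d)) -
      (z - b) * (z - b - d) / (2 * d) * (d / (z - a)\<^sup>2) \<noteq> 0"
    using ne by simp
qed


section \<open>Reduction of the residues by parity\<close>

lemma coeff1_swap: "coeff1 a b r s = coeff1 b a s r"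
  by (simp add: coeff1_def fun_eq_iff)

lemma coeff2_swap: "coeff2 a b \<alpha> \<beta> \<delta> = coeff2 b a \<beta> \<alpha> \<delta>"
  by (simp add: coeff2_def fun_eq_iff)

lemma complex_sqrt_exists: "\<exists>c::complex. c\<^sup>2 = z"
  using power2_csqrt by blast

context
  fixes a b :: complex and x :: cp1 and \<rho> :: "(real \<Rightarrow> cp1) set \<Rightarrow> complex^2^2"
begin

definition realizes :: "complex \<Rightarrow> complex \<Rightarrow> complex \<Rightarrow> complex \<Rightarrow> complex \<Rightarrow> bool" where
  "realizes r s \<alpha> \<beta> \<delta> \<longleftrightarrow>
     monodromy_representation {Fin a, Fin b, Infty} (coeff1 a b r s) (coeff2 a b \<alpha> \<beta> \<delta>) x \<rho>"

context
  assumes ab: "a \<noteq> b" and x: "x \<notin> {Fin a, Fin b, Infty}"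
begin

lemma realizes_gauge:
  "realizes r s \<alpha> \<beta> \<delta> \<Longrightarrow>
   gauge (- {a, b}) (coeff1 a b r s) (coeff2 a b \<alpha> \<beta> \<delta>) (coeff1 a b r' s') (coeff2 a b \<alpha>' \<beta>' \<delta>') p q p2 q2 \<Longrightarrow>
   realizes r' s' \<alpha>' \<beta>' \<delta>'"
  unfolding realizes_def by (rule monodromy_representation_gauge[OF _ x])

lemma realizes_even_shift:
  assumes "realizes r s \<alpha> \<beta> \<delta>"
  shows "\<exists>\<alpha> \<beta> \<delta>. realizes (r - 2 * of_int k) (s - 2 * of_int l) \<alpha> \<beta> \<delta>"
  using realizes_gauge[OF assms gauge_scalar] by blast

text \<open>For r = s = 1 the exponents are the square roots of -\<alpha> at a and of -\<beta> at b,
  and the constant K of \<open>gauge_shift_finite\<close> is 2 \<mu> \<nu> + \<mu> + \<nu> +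
  \<delta>. One shift leads to residues (2, 2), which a scalar factor removes.\<close>

lemma realizes_0_0_if_1_1:
  assumes "realizes 1 1 \<alpha> \<beta> \<delta>"
  shows "\<exists>\<alpha> \<beta> \<delta>. realizes 0 0 \<alpha> \<beta> \<delta>"
proof -
  obtain A B where A: "A\<^sup>2 = - \<alpha>" and B: "B\<^sup>2 = - \<beta>"
    using complex_sqrt_exists by metis
  have shift: ?thesis if "\<mu>\<^sup>2 = - \<alpha>" "\<nu>\<^sup>2 = - \<beta>" "2 * \<mu> * \<nu> + \<mu> + \<nu> + \<delta> \<noteq> 0" for \<mu> \<nu>
  proof -
    have "\<exists>\<alpha> \<beta> \<delta>. realizes (1 + 1) (1 + 1) \<alpha> \<beta> \<delta>"
      by (rule exI, rule exI, rule exI, rule realizes_gauge[OF assms],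
          rule gauge_shift_finite[of "2 * \<mu> * \<nu> + \<mu> + \<nu> + \<delta>" _ \<mu> _ _ \<nu>])
        (use that in \<open>auto simp: algebra_simps\<close>)
    then show ?thesis
      using realizes_even_shift[of "1 + 1" "1 + 1" _ _ _ 1 1] by auto
  qed
  show ?thesis
  proof (cases "2 * A * B + A + B + \<delta> = 0 \<and> 2 * A * B - A - B + \<delta> = 0 \<and>
      - 2 * A * B + A - B + \<delta> = 0 \<and> - 2 * A * B - A + B + \<delta> = 0")
    case True
    \<comment> \<open>The constants for (A, B) and (-A, -B) differ by 2 (A + B), those for (A, -B)
      and (-A, B) by 2 (A - B).\<close>
    then have "A + B = 0" "A - B = 0"
      by algebra+
    then have "A = 0" "B = 0"
      by algebra+
    with True A B have "\<alpha> = 0" "\<beta> = 0" "\<delta> = 0"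
      by auto
    then show ?thesis
      using realizes_gauge[OF _ gauge_log_finite[OF ab]] assms by blast
  next
    case False
    then show ?thesis
      using shift[of A B] shift[of "- A" "- B"] shift[of A "- B"] shift[of "- A" B] A B by auto
  qed
qed

text \<open>The exponents at b are the square roots of -\<beta>, and the growth exponents \<mu> +
  \<nu> at infinity are those of -(\<alpha> + \<beta> + \<delta>). The constant of
  \<open>gauge_shift_infinity\<close> is \<mu>^2 - \<mu> + \<alpha>, and the shift again ends at (2,
  2).\<close>

lemma realizes_0_0_if_0_1:
  assumes "realizes 0 1 \<alpha> \<beta> \<delta>"
  shows "\<exists>\<alpha> \<beta> \<delta>. realizes 0 0 \<alpha> \<beta> \<delta>"
proof -
  obtain B C where B: "B\<^sup>2 = - \<beta>" and C: "C\<^sup>2 = - (\<alpha> + \<beta> + \<delta>)"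
    using complex_sqrt_exists by metis
  have shift: ?thesis if "\<nu>\<^sup>2 = - \<beta>" "(\<mu> + \<nu>)\<^sup>2 = - (\<alpha> + \<beta> + \<delta>)" "\<mu>\<^sup>2 - \<mu> + \<alpha> \<noteq> 0" for \<mu> \<nu>
  proof -
    \<comment> \<open>Subtracting the equation for \<nu> from the one for \<mu> + \<nu> gives the
      form of \<delta> that the shift expects.\<close>
    have \<delta>: "\<delta> = - (\<mu>\<^sup>2 - \<mu> + \<alpha>) - 2 * \<mu> * \<nu> - 0 * \<nu> - 1 * \<mu>"
      using that(1,2) by algebra
    have "\<exists>\<alpha> \<beta> \<delta>. realizes (0 + 2) (1 + 1) \<alpha> \<beta> \<delta>"
      by (rule exI, rule exI, rule exI, rule realizes_gauge[OF assms],
          rule gauge_shift_infinity[OF that(3) ab _ _ \<delta>])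
        (use that(1) in \<open>auto simp: algebra_simps\<close>)
    then show ?thesis
      using realizes_even_shift[of "0 + 2" "1 + 1" _ _ _ 1 1] by auto
  qed
  show ?thesis
  proof (cases "(C + B)\<^sup>2 - (C + B) + \<alpha> = 0 \<and> (- C - B)\<^sup>2 - (- C - B) + \<alpha> = 0 \<and>
      (C - B)\<^sup>2 - (C - B) + \<alpha> = 0 \<and> (B - C)\<^sup>2 - (B - C) + \<alpha> = 0")
    case True
    then have "C + B = 0" "C - B = 0"
      by algebra+
    then have "C = 0" "B = 0"
      by algebra+
    with True B C have "\<alpha> = 0" "\<beta> = 0" "\<delta> = 0"
      by auto
    then show ?thesis
      using realizes_gauge[OF _ gauge_log_infinity[OF ab]] assms by blast
  next
    case False
    then show ?thesis
      \<comment> \<open>The first argument is \<nu>, the second \<mu>; the pairs (\<nu>, \<mu> +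
        \<nu>) run through (-B, C), (B, -C), (B, C), (-B, -C).\<close>
      using shift[of "- B" "C + B"] shift[of B "- C - B"] shift[of B "C - B"] shift[of "- B" "B - C"] B C
      by auto
  qed
qed

end

end

text \<open>Subtracting 2 (r div 2) and 2 (s div 2) leaves residues 0 or 1; the case (1, 0) becomes
  (0, 1) by exchanging a and b.\<close>

lemma sturm_liouville_reduction:
  fixes r s :: int
  assumes "a \<noteq> b" "x \<notin> {Fin a, Fin b, Infty}"
    and "monodromy_representation {Fin a, Fin b, Infty} (coeff1 a b (of_int r) (of_int s)) (coeff2 a b \<alpha> \<beta> \<delta>) x \<rho>"
  shows "\<exists>\<alpha> \<beta> \<delta>. monodromy_representation {Fin a, Fin b, Infty} (coeff1 a b 0 0) (coeff2 a b \<alpha> \<beta> \<delta>) x \<rho>"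
proof -
  have ba: "b \<noteq> a" "x \<notin> {Fin b, Fin a, Infty}"
    using assms by auto
  obtain \<alpha>' \<beta>' \<delta>' where R: "realizes a b x \<rho> (of_int r - 2 * of_int (r div 2)) (of_int s - 2 * of_int (s div 2)) \<alpha>' \<beta>' \<delta>'"
    using realizes_even_shift[OF assms(1,2), of \<rho> "of_int r" "of_int s" \<alpha> \<beta> \<delta> "r div 2" "s div 2"] assms(3)
    by (auto simp: realizes_def)
  have mod2: "of_int i - 2 * of_int (i div 2) = (of_int (i mod 2) :: complex)" for i :: int
    by (metis minus_mult_div_eq_mod of_int_diff of_int_mult of_int_numeral)
  have R': "realizes a b x \<rho> (of_int (r mod 2)) (of_int (s mod 2)) \<alpha>' \<beta>' \<delta>'"
    using R by (simp only: mod2)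
  have sym: "realizes a b x \<rho> r s \<alpha> \<beta> \<delta> \<longleftrightarrow> realizes b a x \<rho> s r \<beta> \<alpha> \<delta>" for r s \<alpha> \<beta> \<delta>
    by (simp add: realizes_def coeff1_swap[of a] coeff2_swap[of a] insert_commute)
  consider "r mod 2 = 0" "s mod 2 = 0" | "r mod 2 = 1" "s mod 2 = 1"
    | "r mod 2 = 0" "s mod 2 = 1" | "r mod 2 = 1" "s mod 2 = 0"
    by linarith
  then have "\<exists>\<alpha> \<beta> \<delta>. realizes a b x \<rho> 0 0 \<alpha> \<beta> \<delta>"
  proof cases
    case 1
    with R' show ?thesis by auto
  next
    case 2
    with R' show ?thesis using realizes_0_0_if_1_1[OF assms(1,2)] by auto
  next
    case 3
    with R' show ?thesis using realizes_0_0_if_0_1[OF assms(1,2)] by auto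
  next
    case 4
    with R' have "realizes b a x \<rho> 0 1 \<beta>' \<alpha>' \<delta>'" using sym by auto
    then show ?thesis using realizes_0_0_if_0_1[OF ba] sym by blast
  qed
  then show ?thesis
    by (simp add: realizes_def)
qed


section \<open>Integrality of the residues\<close>

text \<open>The equation W' = - b1 W makes W a constant multiple of (z - a)^(-r) (z - b)^(-s). A and
  B stand for chosen logarithms of z0 - a and z0 - b. On the ball (z - a)/(z0 - a) has distance less
  than 1 from 1, hence positive real part, so the principal \<open>Ln\<close> continues the
  choice.\<close>

lemma wronskian_explicit:
  fixes r s :: complex
  assumes W: "\<And>z. z \<in> ball z0 e \<Longrightarrow> (W has_field_derivative - coeff1 a b r s z * W z) (at z)"
    and ab: "a \<notin> ball z0 e" "b \<notin> ball z0 e" and z: "z \<in> ball z0 e"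
  shows "W z * exp (r * (A + Ln ((z - a) / (z0 - a))) + s * (B + Ln ((z - b) / (z0 - b))))
       = W z0 * exp (r * A + s * B)"
proof -
  have e: "e > 0" using z zero_le_dist[of z0 z] unfolding mem_ball by linarith
  have ne: "z0 - a \<noteq> 0" "z0 - b \<noteq> 0"
    using ab e by auto
  have nonpos: "(z - c) / (z0 - c) \<notin> \<real>\<^sub>\<le>\<^sub>0" "z \<noteq> c" if c: "c \<notin> ball z0 e" and z: "z \<in> ball z0 e" for c z
  proof -
    have "cmod (z - z0) < cmod (z0 - c)"
      using c z by (simp add: dist_norm norm_minus_commute)
    moreover have "z0 - c \<noteq> 0" using c e by auto
    ultimately have "cmod ((z - z0) / (z0 - c)) < 1"
      by (simp add: norm_divide)
    moreover have "(z - z0) / (z0 - c) = (z - c) / (z0 - c) - 1"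
      using \<open>z0 - c \<noteq> 0\<close> by (simp add: field_simps)
    ultimately have "cmod (1 - (z - c) / (z0 - c)) < 1"
      by (simp add: norm_minus_commute)
    then have "\<bar>Re (1 - (z - c) / (z0 - c))\<bar> < 1"
      using abs_Re_le_cmod le_less_trans by blast
    then have "Re ((z - c) / (z0 - c)) > 0"
      by simp
    then show "(z - c) / (z0 - c) \<notin> \<real>\<^sub>\<le>\<^sub>0"
      by (simp add: complex_nonpos_Reals_iff)
    show "z \<noteq> c" using c z by auto
  qed
  define H where "H z = W z * exp (r * (A + Ln ((z - a) / (z0 - a))) + s * (B + Ln ((z - b) / (z0 - b))))" for z
  have Ln': "((\<lambda>z. Ln ((z - c) / (z0 - c))) has_field_derivative 1 / (z - c)) (at z)"
    if c: "c \<notin> ball z0 e" and z: "z \<in> ball z0 e" for c z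
  proof -
    have "z0 - c \<noteq> 0" using c e by auto
    then show ?thesis
      using nonpos[OF c z] by - (rule derivative_eq_intros refl | simp)+
  qed
  have "(H has_field_derivative 0) (at z)" if z: "z \<in> ball z0 e" for z
    unfolding H_def
    by (rule derivative_eq_intros W[OF z] Ln'[OF ab(1) z] Ln'[OF ab(2) z] refl)+
      (simp add: coeff1_def algebra_simps)
  then have "H constant_on ball z0 e"
    by (intro has_field_derivative_0_imp_constant_on) auto
  then have "H z = H z0"
    using z e unfolding constant_on_def by (metis centre_in_ball)
  then show ?thesis
    using ne by (simp add: H_def)
qed

definition wronskian :: "(complex \<Rightarrow> complex) \<Rightarrow> (complex \<Rightarrow> complex) \<Rightarrow> complex \<Rightarrow> complex" where
  "wronskian f g z = f z * deriv g z - deriv f z * g z"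

lemma DERIV_wronskian:
  assumes "ode_on b1 b2 V f" "ode_on b1 b2 V g" "open V" "z \<in> V"
  shows "(wronskian f g has_field_derivative - b1 z * wronskian f g z) (at z)"
  unfolding wronskian_def
  by (rule derivative_eq_intros ode_onD[OF assms(1,3,4)] ode_onD[OF assms(2,3,4)] refl)+
    (simp add: algebra_simps)

text \<open>Where f does not vanish, g/f has derivative W/f^2 = 0; the identity theorem spreads g =
  k f over the ball.\<close>

lemma wronskian_eq_0_imp_dependent:
  assumes hol: "f holomorphic_on ball z0 e" "g holomorphic_on ball z0 e" and "e > 0"
    and W: "\<And>z. z \<in> ball z0 e \<Longrightarrow> wronskian f g z = 0"
  shows "\<exists>c d. (c, d) \<noteq> (0, 0) \<and> (\<forall>z\<in>ball z0 e. c * f z + d * g z = 0)"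
proof (cases "\<forall>z\<in>ball z0 e. f z = 0")
  case True
  then show ?thesis
    by (intro exI[of _ 1] exI[of _ 0]) auto
next
  case False
  then obtain z1 where z1: "z1 \<in> ball z0 e" "f z1 \<noteq> 0" by blast
  have "open (ball z0 e \<inter> f -` (- {0}))"
    using hol by (intro continuous_open_preimage holomorphic_on_imp_continuous_on) auto
  then obtain d where d: "d > 0" "ball z1 d \<subseteq> ball z0 e \<inter> f -` (- {0})"
    using z1 by (metis IntI ComplI empty_iff insert_iff open_contains_ball vimageI)
  have "((\<lambda>z. g z / f z) has_field_derivative 0) (at z)" if "z \<in> ball z1 d" for z
  proof -
    have z: "z \<in> ball z0 e" "f z \<noteq> 0" using d that by auto
    have "(g has_field_derivative deriv g z) (at z)" "(f has_field_derivative deriv f z) (at z)"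
      using hol z by (auto intro: holomorphic_derivI)
    from DERIV_divide[OF this z(2)] show ?thesis
      by (rule DERIV_cong) (use z W[OF z(1)] in \<open>auto simp: wronskian_def algebra_simps\<close>)
  qed
  then have "(\<lambda>z. g z / f z) constant_on ball z1 d"
    by (intro has_field_derivative_0_imp_constant_on) auto
  then obtain k where k: "\<And>z. z \<in> ball z1 d \<Longrightarrow> g z / f z = k"
    by (auto simp: constant_on_def)
  have "g z = k * f z" if "z \<in> ball z0 e" for z
  proof (rule analytic_continuation_open[of "ball z1 d" "ball z0 e" g "\<lambda>z. k * f z"])
    show "g z = k * f z" if "z \<in> ball z1 d" for z
    proof -
      have "f z \<noteq> 0" using d(2) that by blast
      then show ?thesis using k[OF that] by (auto simp: field_simps)
    qed
  qed (use d that hol in \<open>auto intro!: holomorphic_intros\<close>)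
  then show ?thesis
    by (intro exI[of _ "- k"] exI[of _ 1]) auto
qed

lemma solution_basis_nbhd:
  fixes Y :: "cp1 \<Rightarrow> complex^2"
  assumes "local_solution b1 b2 (Fin z) (\<lambda>z. Y z $ 1)" "local_solution b1 b2 (Fin z) (\<lambda>z. Y z $ 2)"
    and "z \<noteq> a" "z \<noteq> b"
  obtains e where "e > 0" "a \<notin> ball z e" "b \<notin> ball z e"
    "ode_on b1 b2 (ball z e) (\<lambda>z. Y (Fin z) $ 1)" "ode_on b1 b2 (ball z e) (\<lambda>z. Y (Fin z) $ 2)"
proof -
  obtain V1 V2 where V: "open V1" "z \<in> V1" "ode_on b1 b2 V1 (\<lambda>z. Y (Fin z) $ 1)"
    "open V2" "z \<in> V2" "ode_on b1 b2 V2 (\<lambda>z. Y (Fin z) $ 2)"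
    using assms(1,2) unfolding local_solution_Fin by blast
  have "open (V1 \<inter> V2 \<inter> - {a, b})"
    using V by (intro open_Int) auto
  then obtain e where e: "e > 0" "ball z e \<subseteq> V1 \<inter> V2 \<inter> - {a, b}"
    using V assms(3,4) by (metis IntI ComplI insertE empty_iff open_contains_ball)
  show ?thesis
    by (rule that[of e]) (use e V in \<open>auto intro: ode_on_subset[OF V(3)] ode_on_subset[OF V(6)]\<close>)
qed

text \<open>A zero of the Wronskian at z spreads over a disc by \<open>wronskian_explicit\<close>,
  making the two components dependent.\<close>

lemma solution_basis_wronskian:
  fixes Y :: "cp1 \<Rightarrow> complex^2"
  assumes Y: "solution_basis (coeff1 a b r s) b2 (Fin z) Y" and ne: "z \<noteq> a" "z \<noteq> b"
  shows "wronskian (\<lambda>z. Y (Fin z) $ 1) (\<lambda>z. Y (Fin z) $ 2) z \<noteq> 0"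
proof
  let ?W = "wronskian (\<lambda>z. Y (Fin z) $ 1) (\<lambda>z. Y (Fin z) $ 2)"
  assume W0: "?W z = 0"
  have ls: "local_solution (coeff1 a b r s) b2 (Fin z) (\<lambda>z. Y z $ i)" for i
    using Y by (simp add: solution_basis_def)
  obtain e where e: "e > 0" "a \<notin> ball z e" "b \<notin> ball z e"
    and ode: "ode_on (coeff1 a b r s) b2 (ball z e) (\<lambda>z. Y (Fin z) $ 1)"
      "ode_on (coeff1 a b r s) b2 (ball z e) (\<lambda>z. Y (Fin z) $ 2)"
    using solution_basis_nbhd[OF ls ls ne] by blast
  have W: "?W w = 0" if "w \<in> ball z e" for w
    using wronskian_explicit[OF DERIV_wronskian[OF ode open_ball] e(2,3) that, where A = 0 and B = 0] W0
    by simp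
  have hol: "(\<lambda>z. Y (Fin z) $ 1) holomorphic_on ball z e" "(\<lambda>z. Y (Fin z) $ 2) holomorphic_on ball z e"
    using ode by (simp_all add: ode_on_def)
  obtain c d where cd: "(c, d) \<noteq> (0, 0)" "\<forall>w\<in>ball z e. c * Y (Fin w) $ 1 + d * Y (Fin w) $ 2 = 0"
    using wronskian_eq_0_imp_dependent[OF hol e(1) W] by auto
  \<comment> \<open>The contradiction is with uniqueness of coordinates for the zero
    solution.\<close>
  have "local_solution (coeff1 a b r s) b2 (Fin z) (\<lambda>_. 0)"
    using local_solution_linear_combination[OF ls[of 1] ls[of 1], of 0 0] by simp
  then have uniq: "\<exists>!c::complex^2. \<forall>\<^sub>F z in nhds (Fin z). 0 = (\<Sum>i\<in>UNIV. c $ i * Y z $ i)"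
    using Y unfolding solution_basis_def by blast
  have "\<forall>\<^sub>F w in nhds (Fin z). 0 = (\<Sum>i\<in>UNIV. (vector [c, d] :: complex^2) $ i * Y w $ i)"
    unfolding eventually_nhds_Fin
    using eventually_nhds_in_open[OF open_ball, of z z e] e(1) cd(2)
    by (auto simp: sum_2 elim!: eventually_mono)
  moreover have "\<forall>\<^sub>F w in nhds (Fin z). 0 = (\<Sum>i\<in>UNIV. (0 :: complex^2) $ i * Y w $ i)"
    by simp
  ultimately have "(vector [c, d] :: complex^2) = 0"
    using uniq by blast
  then show False
    using cd(1) vector_2[of c d] by (metis prod.inject zero_index)
qed

text \<open>Along the loop the Wronskian picks up the factor exp(-2 pi i (r m + s n)), with m and n
  the winding numbers around a and b, while Y = Y* G changes it by det G = 1. As the Wronskian is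
  nonzero, the factor is 1.\<close>

lemma monodromy_wronskian:
  fixes g :: "real \<Rightarrow> complex"
  assumes Y: "solution_basis (coeff1 a b r s) b2 (Fin x) Y"
    and g: "path g" "pathstart g = x" "pathfinish g = x" "a \<notin> path_image g" "b \<notin> path_image g"
    and G: "monodromy_matrix (coeff1 a b r s) b2 Y (Fin \<circ> g) G" "det G = 1"
  shows "exp (2 * of_real pi * \<i> * (r * winding_number g a + s * winding_number g b)) = 1"
proof -
  obtain F where F: "continuation_along (coeff1 a b r s) b2 (Fin \<circ> g) F"
    and F0: "\<forall>\<^sub>F z in nhds x. F 0 (Fin z) = Y (Fin z)"
    and F1: "\<forall>\<^sub>F z in nhds x. Y (Fin z) = F 1 (Fin z) v* G"
    using G(1) by (auto simp: monodromy_matrix_def pathstart_compose pathfinish_compose g eventually_nhds_Fin)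
  define W where "W t = wronskian (\<lambda>z. F t (Fin z) $ 1) (\<lambda>z. F t (Fin z) $ 2)" for t
  have W_cong: "wronskian (\<lambda>z. A (Fin z) $ 1) (\<lambda>z. A (Fin z) $ 2) z
      = wronskian (\<lambda>z. B (Fin z) $ 1) (\<lambda>z. B (Fin z) $ 2) z"
    if "\<forall>\<^sub>F z in nhds z. A (Fin z) = B (Fin z)" for A B :: "cp1 \<Rightarrow> complex^2" and z
  proof -
    have "deriv (\<lambda>z. A (Fin z) $ i) z = deriv (\<lambda>z. B (Fin z) $ i) z" for i
      using that by (intro deriv_cong_ev) (auto elim: eventually_mono)
    moreover have "A (Fin z) = B (Fin z)"
      using that by (rule eventually_nhds_x_imp_x)
    ultimately show ?thesis
      by (simp add: wronskian_def)
  qed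
  have ne: "g t \<noteq> a" "g t \<noteq> b" if "t \<in> {0..1}" for t
    using g that by (auto simp: path_image_def)
  obtain la where la: "path la" "pathfinish la - pathstart la = 2 * of_real pi * \<i> * winding_number g a"
    "\<And>t. t \<in> {0..1} \<Longrightarrow> g t = a + exp (la t)"
    using winding_number_as_continuous_log[OF g(1,4)] by blast
  obtain lb where lb: "path lb" "pathfinish lb - pathstart lb = 2 * of_real pi * \<i> * winding_number g b"
    "\<And>t. t \<in> {0..1} \<Longrightarrow> g t = b + exp (lb t)"
    using winding_number_as_continuous_log[OF g(1,5)] by blast
  \<comment> \<open>With continuous logarithms of g - a and g - b along the path, \<phi> is the
    Wronskian times (z - a)^r (z - b)^s; it is locally constant in t, so equal at both ends.\<close>
  define \<phi> where "\<phi> t = W t (g t) * exp (r * la t + s * lb t)" for t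
  have ls: "local_solution (coeff1 a b r s) b2 (Fin (g t)) (\<lambda>z. F t z $ i)" if "t \<in> {0..1}" for t i
    using F that by (auto simp: continuation_along_def)
  have "\<forall>\<^sub>F u in at t within {0..1}. \<phi> t = \<phi> u" if t: "t \<in> {0..1}" for t
  proof -
    obtain e where e: "e > 0" "a \<notin> ball (g t) e" "b \<notin> ball (g t) e"
      and ode: "ode_on (coeff1 a b r s) b2 (ball (g t) e) (\<lambda>z. F t (Fin z) $ 1)"
        "ode_on (coeff1 a b r s) b2 (ball (g t) e) (\<lambda>z. F t (Fin z) $ 2)"
      using solution_basis_nbhd[OF ls ls ne, OF t t t t] by blast
    have near: "\<forall>\<^sub>F u in at t within {0..1}. dist (h u) (h t) < \<epsilon>" if "path h" "\<epsilon> > 0"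
      for h :: "real \<Rightarrow> complex" and \<epsilon>
      using that t unfolding path_def continuous_on_def by (auto simp: tendsto_iff)
    have "\<forall>\<^sub>F u in at t within {0..1}. \<forall>\<^sub>F z in nhds (g u). F u (Fin z) = F t (Fin z)"
      using F t by (auto simp: continuation_along_def eventually_nhds_Fin)
    moreover have "\<forall>\<^sub>F u in at t within {0..1}. u \<in> {0..1}"
      by (simp add: eventually_at_filter)
    ultimately show ?thesis
      \<comment> \<open>The bound pi keeps the imaginary part of each change of logarithm inside
        (-pi, pi), where \<open>Ln\<close> inverts \<open>exp\<close>.\<close>
      using near[OF g(1) e(1)] near[OF la(1) pi_gt_zero] near[OF lb(1) pi_gt_zero]
    proof eventually_elim
      case (elim u)
      have Ln: "l t + Ln ((g u - c) / (g t - c)) = l u"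
        if "\<And>t. t \<in> {0..1} \<Longrightarrow> g t = c + exp (l t)" "dist (l u) (l t) < pi" for l c
      proof -
        have "(g u - c) / (g t - c) = exp (l u - l t)"
          using that(1)[OF t] that(1)[OF elim(2)] by (simp add: exp_diff)
        moreover have "\<bar>Im (l u - l t)\<bar> < pi"
          using that(2) abs_Im_le_cmod[of "l u - l t"] by (simp add: dist_norm)
        ultimately show ?thesis
          by (simp add: Ln_exp)
      qed
      have "\<phi> u = W t (g u) * exp (r * la u + s * lb u)"
        using W_cong[OF elim(1)] by (simp add: \<phi>_def W_def)
      also have "\<dots> = \<phi> t"
      proof -
        have "g u \<in> ball (g t) e"
          using elim(3) by (simp add: dist_commute)
        moreover have "la t + Ln ((g u - a) / (g t - a)) = la u" "lb t + Ln ((g u - b) / (g t - b)) = lb u"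
          by (rule Ln, use la(3) elim(4) in auto, rule Ln, use lb(3) elim(5) in auto)
        ultimately show ?thesis
          using wronskian_explicit[OF DERIV_wronskian[OF ode open_ball] e(2,3), of "g u" "la t" "lb t"]
          by (simp add: \<phi>_def W_def)
      qed
      finally show ?case by simp
    qed
  qed
  then have \<phi>: "\<phi> 0 = \<phi> 1"
    by (intro connected_local_const[of "{0..1::real}"]) auto
  have g01: "g 0 = x" "g 1 = x"
    using g by (auto simp: pathstart_def pathfinish_def)
  let ?WY = "wronskian (\<lambda>z. Y (Fin z) $ 1) (\<lambda>z. Y (Fin z) $ 2) x"
  have "W 0 x = ?WY"
    using W_cong[OF F0] by (simp add: W_def)
  moreover have "?WY = W 1 x"
  proof -
    have d: "(\<lambda>z. F 1 (Fin z) $ i) field_differentiable at x" for i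
    proof -
      obtain V where "open V" "x \<in> V" "ode_on (coeff1 a b r s) b2 V (\<lambda>z. F 1 (Fin z) $ i)"
        using ls[of 1 i] unfolding local_solution_Fin g01 by auto
      from ode_onD(1)[OF this(3,1,2)] show ?thesis
        by (auto simp: field_differentiable_def)
    qed
    have "?WY = wronskian (\<lambda>z. (F 1 (Fin z) v* G) $ 1) (\<lambda>z. (F 1 (Fin z) v* G) $ 2) x"
      by (rule W_cong[of Y "\<lambda>z. F 1 z v* G", OF F1])
    also have "\<dots> = wronskian (\<lambda>z. G $ 1 $ 1 * F 1 (Fin z) $ 1 + G $ 2 $ 1 * F 1 (Fin z) $ 2)
        (\<lambda>z. G $ 1 $ 2 * F 1 (Fin z) $ 1 + G $ 2 $ 2 * F 1 (Fin z) $ 2) x"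
      by (simp add: vector_matrix_mult_def sum_2 mult.commute)
    also have "\<dots> = det G * W 1 x"
      unfolding wronskian_def W_def deriv_linear_combination[OF d d] det_2 by (simp add: algebra_simps)
    finally show ?thesis
      using G(2) by simp
  qed
  moreover have "?WY \<noteq> 0"
    using solution_basis_wronskian[OF Y] ne[of 0] g01 by simp
  ultimately have "exp (r * la 0 + s * lb 0) = exp (r * la 1 + s * lb 1)"
    using \<phi> by (simp add: \<phi>_def g01)
  then have "exp ((r * la 1 + s * lb 1) - (r * la 0 + s * lb 0)) = 1"
    by (simp add: exp_diff)
  moreover have "(r * la 1 + s * lb 1) - (r * la 0 + s * lb 0) =
      2 * of_real pi * \<i> * (r * winding_number g a + s * winding_number g b)"
    using la(2) lb(2) by (simp add: pathstart_def pathfinish_def) algebra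
  ultimately show ?thesis by simp
qed

text \<open>A path to a circle around a, one turn, and the same path back: the two traversals of the
  path cancel in both winding numbers.\<close>

lemma loop_around_one_puncture:
  fixes a b x :: complex
  assumes "a \<noteq> b" "x \<noteq> a" "x \<noteq> b"
  obtains g where "path g" "pathstart g = x" "pathfinish g = x" "a \<notin> path_image g" "b \<notin> path_image g"
    "winding_number g a = 1" "winding_number g b = 0"
proof -
  \<comment> \<open>Half the distance keeps b outside the closed disc, so the circle does not wind
    around it.\<close>
  define e where "e = cmod (a - b) / 2"
  have e: "e > 0" "e < cmod (a - b)" using assms by (auto simp: e_def)
  have "path_connected (- {a, b})"
    by (rule path_connected_complement_countable) auto
  moreover have "a + of_real e \<in> - {a, b}"
    using e by auto
  ultimately obtain h where h: "path h" "path_image h \<subseteq> - {a, b}" "pathstart h = x" "pathfinish h = a + of_real e"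
    using assms unfolding path_connected_def by (metis ComplI empty_iff insert_iff)
  have hab: "a \<notin> path_image h" "b \<notin> path_image h" using h(2) by auto
  define c where "c = circlepath a e"
  have b: "b \<notin> cball a e"
    using e by (simp add: dist_norm)
  have c: "path c" "pathstart c = a + of_real e" "pathfinish c = a + of_real e"
    "a \<notin> path_image c" "path_image c \<subseteq> cball a e" "winding_number c a = 1"
    using e by (auto simp: c_def winding_number_circlepath_centre)
  have wb: "winding_number c b = 0"
    by (rule winding_number_zero_outside[of _ "cball a e"]) (use b c in auto)
  have cb: "b \<notin> path_image c" using b c by auto
  define g where "g = h +++ (c +++ reversepath h)"
  show ?thesis
  proof (rule that[of g])
    show "winding_number g a = 1" "winding_number g b = 0"
      using h hab c wb cb
      by (simp_all add: g_def winding_number_join winding_number_reversepath path_image_join not_in_path_image_join)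
  qed (use h hab c cb in \<open>auto simp: g_def path_image_join\<close>)
qed

text \<open>A loop around a alone turns the Wronskian relation into exp(2 pi i r) = 1. The statement
  for s is this one with a and b exchanged.\<close>

lemma integral_residue:
  assumes "a \<noteq> b" "x \<notin> {Fin a, Fin b, Infty}"
    and rep: "monodromy_representation {Fin a, Fin b, Infty} (coeff1 a b r s) b2 x \<rho>"
    and det: "\<And>\<gamma>. \<gamma> \<in> loops (- {Fin a, Fin b, Infty}) x \<Longrightarrow> det (\<rho> (homotopy_class (- {Fin a, Fin b, Infty}) \<gamma>)) = 1"
  shows "r \<in> \<int>"
proof -
  obtain z where z: "x = Fin z" "z \<noteq> a" "z \<noteq> b"
    using assms(2) by (cases x) auto
  obtain g where g: "path g" "pathstart g = z" "pathfinish g = z" "a \<notin> path_image g" "b \<notin> path_image g"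
    "winding_number g a = 1" "winding_number g b = 0"
    using loop_around_one_puncture[OF assms(1) z(2,3)] .
  obtain Y where Y: "solution_basis (coeff1 a b r s) b2 (Fin z) Y"
    and mono: "\<And>\<gamma>. \<gamma> \<in> loops (- {Fin a, Fin b, Infty}) x \<Longrightarrow>
        monodromy_matrix (coeff1 a b r s) b2 Y \<gamma> (\<rho> (homotopy_class (- {Fin a, Fin b, Infty}) \<gamma>))"
    using rep by (auto simp: monodromy_representation_def z)
  have loop: "Fin \<circ> g \<in> loops (- {Fin a, Fin b, Infty}) x"
    using g by (auto simp: loops_def z path_image_compose pathstart_compose pathfinish_compose
        intro!: path_continuous_image continuous_on_Fin)
  have "exp (2 * of_real pi * \<i> * r) = 1"
    using monodromy_wronskian[OF Y g(1-5) mono[OF loop] det[OF loop]] g(6,7) by simp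
  then obtain n :: int where "Re (2 * of_real pi * \<i> * r) = 0" "Im (2 * of_real pi * \<i> * r) = of_int (2 * n) * pi"
    unfolding exp_eq_1 by blast
  then have "r = of_int n"
    by (simp add: complex_eq_iff)
  then show ?thesis by simp
qed


section \<open>Equations with a singular point at infinity\<close>

lemma pole_order_at_mostI:
  assumes "g analytic_on {a}" "\<forall>\<^sub>F z in at a. (z - a) ^ k * f z = g z"
  shows "pole_order_at_most f a k"
  using assms unfolding pole_order_at_most_def by blast

lemma analytic_imp_bounded_near:
  fixes g :: "complex \<Rightarrow> complex"
  assumes "g analytic_on {a}"
  shows "\<exists>M. \<forall>\<^sub>F t in at a. cmod (g t) \<le> M"
proof -
  have "isCont g a"
    using assms analytic_at_imp_isCont by blast
  then have "\<forall>\<^sub>F t in at a. dist (g t) (g a) < 1"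
    by (auto simp: isCont_def tendsto_iff)
  then have "\<forall>\<^sub>F t in at a. cmod (g t) \<le> cmod (g a) + 1"
  proof eventually_elim
    case (elim t)
    then show ?case
      using norm_triangle_ineq[of "g t - g a" "g a"] by (simp add: dist_norm)
  qed
  then show ?thesis by blast
qed

lemma eventually_at_0_imp_at_infinity:
  fixes P :: "complex \<Rightarrow> bool"
  assumes "\<forall>\<^sub>F t in at 0. P (1 / t)"
  shows "\<exists>R. \<forall>z. R \<le> cmod z \<longrightarrow> P z"
proof -
  obtain d where d: "d > 0" "\<And>t. t \<noteq> 0 \<Longrightarrow> cmod t < d \<Longrightarrow> P (1 / t)"
    using assms by (auto simp: eventually_at)
  show ?thesis
  proof (intro exI[of _ "1 / d + 1"] allI impI)
    fix z :: complex
    assume z: "1 / d + 1 \<le> cmod z"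
    then have "1 / d < cmod z" "z \<noteq> 0"
      using d(1) by (auto simp: field_simps add_nonneg_pos)
    then have "cmod (1 / z) < d"
      using d(1) by (simp add: norm_divide field_simps)
    then show "P z"
      using d(2)[of "1 / z"] \<open>z \<noteq> 0\<close> by simp
  qed
qed

text \<open>Clearing the poles gives an entire function E. Since f is O(z^(-k)) at infinity, E is
  O(z^k), and Liouville's theorem bounds its degree by k.\<close>

lemma polynomial_numerator:
  assumes ab: "a \<noteq> b" and f: "f holomorphic_on - {a, b}"
    and pole: "pole_order_at_most f a k" "pole_order_at_most f b k"
    and bound: "\<And>z. R \<le> cmod z \<Longrightarrow> cmod (z ^ k * f z) \<le> M"
  obtains c where "\<And>z. z \<noteq> a \<Longrightarrow> z \<noteq> b \<Longrightarrow> (z - a) ^ k * (z - b) ^ k * f z = (\<Sum>i\<le>k. c i * z ^ i)"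
proof -
  obtain ga gb where ga: "ga analytic_on {a}" "\<forall>\<^sub>F z in at a. (z - a) ^ k * f z = ga z"
    and gb: "gb analytic_on {b}" "\<forall>\<^sub>F z in at b. (z - b) ^ k * f z = gb z"
    using pole by (auto simp: pole_order_at_most_def)
  \<comment> \<open>At a and b the values are the limits supplied by the local extensions
    \<open>ga\<close> and \<open>gb\<close>.\<close>
  define E where "E z = (if z = a then (a - b) ^ k * ga a else if z = b then (b - a) ^ k * gb b
      else (z - a) ^ k * (z - b) ^ k * f z)" for z
  have "\<forall>\<^sub>F z in at a. z \<noteq> b" "\<forall>\<^sub>F z in at b. z \<noteq> a"
    using ab by (auto intro!: eventually_neq_at_within)
  note ev = this
  have "\<forall>\<^sub>F z in at a. E z = (z - b) ^ k * ga z"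
    using ga(2) ev(1) by eventually_elim (use ab in \<open>auto simp: E_def\<close>)
  then have ev_a: "\<forall>\<^sub>F z in nhds a. E z = (z - b) ^ k * ga z"
    by (simp add: eventually_nhds_conv_at E_def)
  have "(\<lambda>z. (z - b) ^ k * ga z) analytic_on {a}"
    using ga(1) by (intro analytic_intros)
  then have Ea: "E analytic_on {a}"
    using analytic_at_cong[OF ev_a refl] by simp
  have "\<forall>\<^sub>F z in at b. E z = (z - a) ^ k * gb z"
    using gb(2) ev(2) by eventually_elim (use ab in \<open>auto simp: E_def\<close>)
  then have ev_b: "\<forall>\<^sub>F z in nhds b. E z = (z - a) ^ k * gb z"
    using ab by (simp add: eventually_nhds_conv_at E_def)
  have "(\<lambda>z. (z - a) ^ k * gb z) analytic_on {b}"
    using gb(1) by (intro analytic_intros)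
  then have Eb: "E analytic_on {b}"
    using analytic_at_cong[OF ev_b refl] by simp
  have Ez: "E analytic_on {z}" if "z \<in> - {a, b}" for z
  proof (rule holomorphic_on_imp_analytic_at)
    show "E holomorphic_on - {a, b}"
    proof (rule holomorphic_transform)
      show "(\<lambda>z. (z - a) ^ k * (z - b) ^ k * f z) holomorphic_on - {a, b}"
        by (intro holomorphic_intros f)
    qed (auto simp: E_def)
    show "open (- {a, b})"
      by auto
  qed (fact that)
  have "E analytic_on {z}" for z
    using Ea Eb Ez[of z] by (cases "z = a"; cases "z = b") auto
  then have "E analytic_on UNIV"
    unfolding analytic_on_analytic_at[of E UNIV] by simp
  then have E: "E holomorphic_on UNIV"
    by (rule analytic_imp_holomorphic)
  \<comment> \<open>The threshold excludes a and b, exceeds R, and makes both |z - a| and |z - b| at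
    most 2 |z|, whence the factor 4^k.\<close>
  have "cmod (E z) \<le> 4 ^ k * M * cmod z ^ k" if z: "cmod a + cmod b + 1 + \<bar>R\<bar> \<le> cmod z" for z
  proof -
    have ne: "z \<noteq> a" "z \<noteq> b"
      using z norm_ge_zero[of a] norm_ge_zero[of b] abs_ge_zero[of R] by (safe, linarith, linarith)
    have "cmod (z - a) \<le> 2 * cmod z" "cmod (z - b) \<le> 2 * cmod z"
      using z norm_triangle_ineq4[of z a] norm_triangle_ineq4[of z b] norm_ge_zero[of a] norm_ge_zero[of b]
      by linarith+
    note this[THEN power_mono[OF _ norm_ge_zero], of k]
    then have "cmod (z - a) ^ k * cmod (z - b) ^ k * cmod (f z) \<le> (2 * cmod z) ^ k * (2 * cmod z) ^ k * cmod (f z)"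
      by (intro mult_right_mono mult_mono) auto
    also have "\<dots> = 4 ^ k * cmod z ^ k * cmod (z ^ k * f z)"
    proof -
      have "(2 * cmod z) ^ k * (2 * cmod z) ^ k = 4 ^ k * cmod z ^ k * cmod z ^ k"
        by (simp add: power_mult_distrib mult_ac flip: power_mult_distrib[of 2 2])
      then show ?thesis
        by (simp add: norm_mult norm_power mult_ac)
    qed
    also have "\<dots> \<le> 4 ^ k * cmod z ^ k * M"
    proof -
      have "R \<le> cmod z"
        using z norm_ge_zero[of a] norm_ge_zero[of b] abs_ge_self[of R] by linarith
      then show ?thesis
        by (intro mult_left_mono bound) auto
    qed
    finally show ?thesis
      using ne by (simp add: E_def norm_mult norm_power mult_ac)
  qed
  note E_bound = this
  have E_eq: "E z = (\<Sum>i\<le>k. (deriv ^^ i) E 0 / fact i * z ^ i)" for z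
    by (rule Liouville_polynomial[OF E E_bound])
  show ?thesis
  proof (rule that[of "\<lambda>i. (deriv ^^ i) E 0 / fact i"])
    show "(z - a) ^ k * (z - b) ^ k * f z = (\<Sum>i\<le>k. (deriv ^^ i) E 0 / fact i * z ^ i)"
      if "z \<noteq> a" "z \<noteq> b" for z
      using E_eq[of z] that by (simp add: E_def)
  qed
qed

text \<open>The pole conditions at t = 0 say that z b1 and z^2 b2 stay bounded, so the numerators
  have degrees at most 1 and 2; partial fractions do the rest.\<close>

lemma riemann_equation_normal_form:
  assumes ab: "a \<noteq> b" and eq: "riemann_equation {Fin a, Fin b, Infty} b1 b2"
  obtains r s \<alpha> \<beta> \<delta> where
    "\<And>z. z \<noteq> a \<Longrightarrow> z \<noteq> b \<Longrightarrow> b1 z = coeff1 a b r s z"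
    "\<And>z. z \<noteq> a \<Longrightarrow> z \<noteq> b \<Longrightarrow> b2 z = coeff2 a b \<alpha> \<beta> \<delta> z"
proof -
  have "{z. Fin z \<notin> {Fin a, Fin b, Infty}} = - {a, b}"
    by auto
  then have hol: "b1 holomorphic_on - {a, b}" "b2 holomorphic_on - {a, b}"
    and pole: "pole_order_at_most b1 a 1" "pole_order_at_most b1 b 1"
      "pole_order_at_most b2 a 2" "pole_order_at_most b2 b 2"
      "pole_order_at_most (inf_coeff1 b1) 0 1" "pole_order_at_most (inf_coeff2 b2) 0 2"
    using eq by (auto simp: riemann_equation_def)
  have bounded: "\<exists>g M. (\<forall>\<^sub>F t in at 0. t ^ k * f t = g t) \<and> (\<forall>\<^sub>F t in at 0. cmod (g t) \<le> M)"
    if pole: "pole_order_at_most f 0 k" for f k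
  proof -
    obtain g where "g analytic_on {0}" "\<forall>\<^sub>F t in at 0. t ^ k * f t = g t"
      using pole by (auto simp: pole_order_at_most_def)
    then show ?thesis
      using analytic_imp_bounded_near[of g 0] by blast
  qed
  obtain g1 M1 where g1: "\<forall>\<^sub>F t in at 0. t ^ 1 * inf_coeff1 b1 t = g1 t" "\<forall>\<^sub>F t in at 0. cmod (g1 t) \<le> M1"
    using bounded[OF pole(5)] by blast
  obtain g2 M2 where g2: "\<forall>\<^sub>F t in at 0. t ^ 2 * inf_coeff2 b2 t = g2 t" "\<forall>\<^sub>F t in at 0. cmod (g2 t) \<le> M2"
    using bounded[OF pole(6)] by blast
  have ne0: "\<forall>\<^sub>F t in at (0::complex). t \<noteq> 0"
    by (simp add: eventually_at_filter)
  have "\<forall>\<^sub>F t in at 0. cmod ((1 / t) ^ 1 * b1 (1 / t)) \<le> 2 + M1"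
    using g1 ne0
  proof eventually_elim
    case (elim t)
    have "t ^ 1 * inf_coeff1 b1 t = 2 - (1 / t) ^ 1 * b1 (1 / t)"
      using elim(3) by (simp add: inf_coeff1_def right_diff_distrib power2_eq_square)
    then have "(1 / t) ^ 1 * b1 (1 / t) = 2 - g1 t"
      using elim(1) by algebra
    then show ?case
      using elim(2) norm_triangle_ineq4[of 2 "g1 t"] by simp
  qed
  then obtain R1 where R1: "\<And>z. R1 \<le> cmod z \<Longrightarrow> cmod (z ^ 1 * b1 z) \<le> 2 + M1"
    using eventually_at_0_imp_at_infinity[of "\<lambda>z. cmod (z ^ 1 * b1 z) \<le> 2 + M1"] by blast
  have "\<forall>\<^sub>F t in at 0. cmod ((1 / t) ^ 2 * b2 (1 / t)) \<le> M2"
    using g2 ne0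
  proof eventually_elim
    case (elim t)
    have "(1 / t) ^ 2 * b2 (1 / t) = g2 t"
      using elim(1,3) by (auto simp: inf_coeff2_def field_simps power2_eq_square power4_eq_xxxx)
    then show ?case
      using elim(2) by simp
  qed
  then obtain R2 where R2: "\<And>z. R2 \<le> cmod z \<Longrightarrow> cmod (z ^ 2 * b2 z) \<le> M2"
    using eventually_at_0_imp_at_infinity[of "\<lambda>z. cmod (z ^ 2 * b2 z) \<le> M2"] by blast
  obtain c where c: "\<And>z. z \<noteq> a \<Longrightarrow> z \<noteq> b \<Longrightarrow> (z - a) ^ 1 * (z - b) ^ 1 * b1 z = (\<Sum>i\<le>1. c i * z ^ i)"
    using polynomial_numerator[OF ab hol(1) pole(1,2) R1] by blast
  obtain d where d: "\<And>z. z \<noteq> a \<Longrightarrow> z \<noteq> b \<Longrightarrow> (z - a) ^ 2 * (z - b) ^ 2 * b2 z = (\<Sum>i\<le>2. d i * z ^ i)"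
    using polynomial_numerator[OF ab hol(2) pole(3,4) R2] by blast
  \<comment> \<open>Values of the numerator at a and b, divided by the other linear factor.\<close>
  define r s where "r = (c 0 + c 1 * a) / (a - b)" and "s = (c 0 + c 1 * b) / (b - a)"
  define P where "P z = d 0 + d 1 * z + d 2 * z\<^sup>2" for z
  \<comment> \<open>\<alpha> and \<beta> come from evaluation at a and b, \<delta> from comparing
    the coefficients of z^2.\<close>
  define \<alpha> \<beta> \<delta> where "\<alpha> = P a / (a - b)\<^sup>2" and "\<beta> = P b / (a - b)\<^sup>2" and "\<delta> = d 2 - \<alpha> - \<beta>"
  show ?thesis
  proof (rule that[of r s \<alpha> \<beta> \<delta>])
    fix z assume z: "z \<noteq> a" "z \<noteq> b"
    have "(z - a) * (z - b) * b1 z = c 0 + c 1 * z"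
      using c[OF z] by simp
    also have "\<dots> = r * (z - b) + s * (z - a)"
    proof -
      have "r * (a - b) = c 0 + c 1 * a" "s * (a - b) = - (c 0 + c 1 * b)"
        using ab by (auto simp: r_def s_def field_simps)
      then have "(a - b) * (r * (z - b) + s * (z - a)) = (a - b) * (c 0 + c 1 * z)"
        by algebra
      then show ?thesis
        using ab by simp
    qed
    finally show "b1 z = coeff1 a b r s z"
      using z by (simp add: coeff1_def divide_simps) (simp add: algebra_simps)
    have "(z - a)\<^sup>2 * (z - b)\<^sup>2 * b2 z = P z"
      using d[OF z] by (simp add: P_def numeral_2_eq_2)
    also have "P z = \<alpha> * (z - b)\<^sup>2 + \<beta> * (z - a)\<^sup>2 + \<delta> * (z - a) * (z - b)"
    proof -
      have "\<alpha> * (a - b)\<^sup>2 = P a" "\<beta> * (a - b)\<^sup>2 = P b"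
        using ab by (auto simp: \<alpha>_def \<beta>_def)
      then have "(a - b)\<^sup>2 * (\<alpha> * (z - b)\<^sup>2 + \<beta> * (z - a)\<^sup>2 + (d 2 - \<alpha> - \<beta>) * (z - a) * (z - b)) = (a - b)\<^sup>2 * P z"
        unfolding P_def by algebra
      then show ?thesis
        using ab by (simp add: \<delta>_def)
    qed
    finally show "b2 z = coeff2 a b \<alpha> \<beta> \<delta> z"
      using z by (simp add: coeff2_def divide_simps power2_eq_square) (simp add: algebra_simps)
  qed
qed

text \<open>The normal form agrees with the given coefficients only off the singular points; the
  identity gauge transfers the monodromy.\<close>

lemma gauge_identity:
  assumes "\<And>z. z \<in> S \<Longrightarrow> b1 z = c1 z" "\<And>z. z \<in> S \<Longrightarrow> b2 z = c2 z"
  shows "gauge S b1 b2 c1 c2 (\<lambda>_. 1) (\<lambda>_. 0) (\<lambda>_. 0) (\<lambda>_. 1)"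
  by unfold_locales (use assms in auto)

text \<open>At infinity b1 = 0 becomes 2/t, a simple pole, and t^2 times the second coefficient is
  analytic because each reciprocal 1/(1/t - c) equals t/(1 - c t).\<close>

lemma riemann_sturm_liouville_coeff2:
  assumes "a \<noteq> b"
  shows "riemann_sturm_liouville_equation {Fin a, Fin b, Infty} (coeff2 a b \<alpha> \<beta> \<delta>)"
proof -
  have D: "{z. Fin z \<notin> {Fin a, Fin b, Infty}} = - {a, b}"
    by auto
  have hol: "coeff2 a b \<alpha> \<beta> \<delta> holomorphic_on - {a, b}"
    unfolding coeff2_def[abs_def] by (intro holomorphic_intros) auto
  have zero: "pole_order_at_most (\<lambda>_. 0) c k" for c k
    by (rule pole_order_at_mostI[of "\<lambda>_. 0"]) auto
  have pole: "pole_order_at_most (coeff2 a b \<alpha> \<beta> \<delta>) a 2" if "a \<noteq> b" for a b \<alpha> \<beta> \<delta>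
  proof (rule pole_order_at_mostI)
    show "(\<lambda>z. \<alpha> + \<beta> * ((z - a) / (z - b))\<^sup>2 + \<delta> * ((z - a) / (z - b))) analytic_on {a}"
      using that by (intro analytic_intros) auto
    have "\<forall>\<^sub>F z in at a. z \<noteq> b" "\<forall>\<^sub>F z in at a. z \<noteq> a"
      using that by (auto intro!: eventually_neq_at_within)
    then show "\<forall>\<^sub>F z in at a. (z - a)\<^sup>2 * coeff2 a b \<alpha> \<beta> \<delta> z =
        \<alpha> + \<beta> * ((z - a) / (z - b))\<^sup>2 + \<delta> * ((z - a) / (z - b))"
    proof eventually_elim
      case (elim z)
      define v w where "v = 1 / (z - a)" and "w = 1 / (z - b)"
      have v: "(z - a) * v = 1"
        using elim by (simp add: v_def)
      have "(z - a)\<^sup>2 * (\<alpha> * v\<^sup>2 + \<beta> * w\<^sup>2 + \<delta> * v * w)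
          = \<alpha> + \<beta> * ((z - a) * w)\<^sup>2 + \<delta> * ((z - a) * w)"
        using v by algebra
      then show ?case
        by (simp add: coeff2_def v_def w_def)
    qed
  qed
  have ne0: "\<forall>\<^sub>F t in at (0::complex). t \<noteq> 0"
    by (simp add: eventually_at_filter)
  have inf1: "pole_order_at_most (inf_coeff1 (\<lambda>_. 0)) 0 1"
    by (rule pole_order_at_mostI[of "\<lambda>_. 2"]) (use ne0 in \<open>auto simp: inf_coeff1_def elim: eventually_mono\<close>)
  have inf2: "pole_order_at_most (inf_coeff2 (coeff2 a b \<alpha> \<beta> \<delta>)) 0 2"
  proof (rule pole_order_at_mostI)
    show "(\<lambda>t. \<alpha> / (1 - a * t)\<^sup>2 + \<beta> / (1 - b * t)\<^sup>2 + \<delta> / ((1 - a * t) * (1 - b * t))) analytic_on {0}"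
      by (intro analytic_intros) auto
    have "\<forall>\<^sub>F t in at 0. 1 - c * t \<noteq> 0" for c :: complex
    proof -
      have "((\<lambda>t. 1 - c * t) \<longlongrightarrow> 1 - c * 0) (at 0)"
        by (intro tendsto_intros)
      then show ?thesis
        by (rule tendsto_imp_eventually_ne) simp
    qed
    note this[of a] this[of b]
    then show "\<forall>\<^sub>F t in at 0. (t - 0)\<^sup>2 * inf_coeff2 (coeff2 a b \<alpha> \<beta> \<delta>) t =
        \<alpha> / (1 - a * t)\<^sup>2 + \<beta> / (1 - b * t)\<^sup>2 + \<delta> / ((1 - a * t) * (1 - b * t))"
      using ne0
    proof eventually_elim
      case (elim t)
      have inv: "1 / (1 / t - c) = t / (1 - c * t)" if "1 - c * t \<noteq> 0" for c
        using that elim(3) by (simp add: field_simps)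
      show ?case
        unfolding inf_coeff2_def coeff2_def inv[OF elim(1)] inv[OF elim(2)]
        using elim by (simp add: power2_eq_square power4_eq_xxxx add_divide_distrib distrib_left)
    qed
  qed
  show ?thesis
    unfolding riemann_sturm_liouville_equation_def riemann_equation_def D
    using assms hol zero pole[OF assms, of \<alpha> \<beta> \<delta>] pole[of b a \<beta> \<alpha> \<delta>] inf1 inf2
    by (auto simp: coeff2_swap[of b])
qed

lemma sturm_liouville_if_infinity_singular:
  assumes "a \<noteq> b" "x \<notin> {Fin a, Fin b, Infty}"
    and "riemann_equation {Fin a, Fin b, Infty} b1 b2"
    and "monodromy_representation {Fin a, Fin b, Infty} b1 b2 x \<rho>"
    and "\<And>\<gamma>. \<gamma> \<in> loops (- {Fin a, Fin b, Infty}) x \<Longrightarrow> det (\<rho> (homotopy_class (- {Fin a, Fin b, Infty}) \<gamma>)) = 1"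
  shows "\<exists>q. riemann_sturm_liouville_equation {Fin a, Fin b, Infty} q \<and>
    monodromy_representation {Fin a, Fin b, Infty} (\<lambda>_. 0) q x \<rho>"
proof -
  obtain r s \<alpha> \<beta> \<delta> where b: "\<And>z. z \<noteq> a \<Longrightarrow> z \<noteq> b \<Longrightarrow> b1 z = coeff1 a b r s z"
    "\<And>z. z \<noteq> a \<Longrightarrow> z \<noteq> b \<Longrightarrow> b2 z = coeff2 a b \<alpha> \<beta> \<delta> z"
    using riemann_equation_normal_form[OF assms(1,3)] by blast
  have rep: "monodromy_representation {Fin a, Fin b, Infty} (coeff1 a b r s) (coeff2 a b \<alpha> \<beta> \<delta>) x \<rho>"
    by (rule monodromy_representation_gauge[OF gauge_identity assms(2,4)]) (use b in auto)
  have "r \<in> \<int>"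
    by (rule integral_residue[OF assms(1,2) rep assms(5)])
  moreover have "s \<in> \<int>"
  proof (rule integral_residue)
    show "monodromy_representation {Fin b, Fin a, Infty} (coeff1 b a s r) (coeff2 a b \<alpha> \<beta> \<delta>) x \<rho>"
      using rep by (simp add: coeff1_swap[of b] insert_commute)
    show "det (\<rho> (homotopy_class (- {Fin b, Fin a, Infty}) \<gamma>)) = 1"
      if "\<gamma> \<in> loops (- {Fin b, Fin a, Infty}) x" for \<gamma>
      using assms(5)[of \<gamma>] that by (simp add: insert_commute)
  qed (use assms in auto)
  ultimately obtain i j :: int where "r = of_int i" "s = of_int j"
    by (auto elim!: Ints_cases)
  with rep obtain \<alpha>' \<beta>' \<delta>' where
    "monodromy_representation {Fin a, Fin b, Infty} (coeff1 a b 0 0) (coeff2 a b \<alpha>' \<beta>' \<delta>') x \<rho>"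
    using sturm_liouville_reduction[OF assms(1,2)] by blast
  moreover have "coeff1 a b 0 0 = (\<lambda>_. 0)"
    by (simp add: coeff1_def fun_eq_iff)
  ultimately show ?thesis
    using riemann_sturm_liouville_coeff2[OF assms(1), of \<alpha>' \<beta>' \<delta>'] by auto
qed


section \<open>Moving a singular point to infinity\<close>

text \<open>The map z -> 1/(z - a); writing it with \<open>inf_chart\<close> covers z = a
  too.\<close>

definition to_inf :: "complex \<Rightarrow> cp1 \<Rightarrow> cp1" where
  "to_inf a w = (case w of Fin z \<Rightarrow> inf_chart (z - a) | Infty \<Rightarrow> Fin 0)"

definition from_inf :: "complex \<Rightarrow> cp1 \<Rightarrow> cp1" where
  "from_inf a w = (case w of Fin z \<Rightarrow> if z = 0 then Infty else Fin (a + 1 / z) | Infty \<Rightarrow> Fin a)"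

lemma to_inf_moebius: "to_inf a = moebius_map 0 1 1 (- a)"
  by (auto simp: to_inf_def moebius_map_def inf_chart_def moebius_def fun_eq_iff split: cp1.splits)

lemma from_inf_to_inf [simp]: "from_inf a (to_inf a x) = x"
  by (cases x) (auto simp: to_inf_def from_inf_def inf_chart_def)

lemma to_inf_from_inf [simp]: "to_inf a (from_inf a x) = x"
  by (cases x) (auto simp: to_inf_def from_inf_def inf_chart_def)

lemma from_inf_inf_chart:
  assumes "1 + a * w \<noteq> 0"
  shows "from_inf a (Fin w) = inf_chart (w / (1 + a * w))"
  using assms by (auto simp: from_inf_def inf_chart_def field_simps)

lemma to_inf_inf_chart:
  assumes "1 - a * t \<noteq> 0"
  shows "to_inf a (inf_chart t) = Fin (t / (1 - a * t))"
  using assms by (auto simp: to_inf_def inf_chart_def field_simps)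

lemma open_preimage:
  assumes "open S" "continuous_on S f" "open U"
  shows "open {z \<in> S. f z \<in> U}"
  using continuous_open_preimage[OF assms(2,1,3)] by (simp add: vimage_def Int_def)

lemma open_affine_nonzero: "open {t::complex. c + d * t \<noteq> 0}"
  by (intro open_Collect_neq continuous_intros)

text \<open>In the chart at infinity the preimage is a union of two open sets: where 1 - a t is
  nonzero the map is t/(1 - a t) in the finite chart, where t is nonzero it is 1/t - a in the
  infinite one. The two regions cover everything.\<close>

lemma continuous_to_inf: "continuous_on UNIV (to_inf a)"
proof (rule continuous_on_cp1I)
  fix U :: "cp1 set" assume U: "open U"
  show "open {z. to_inf a (Fin z) \<in> U}"
  proof -
    have "open {z \<in> UNIV. z - a \<in> inf_chart -` U}"
      by (intro open_preimage open_vimage_inf_chart U continuous_intros open_UNIV)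
    then show ?thesis
      by (simp add: to_inf_def)
  qed
  let ?S = "{t. 1 + (- a) * t \<noteq> 0}" and ?S' = "- {0} :: complex set"
  have "{t. to_inf a (inf_chart t) \<in> U} =
      {t \<in> ?S. t / (1 - a * t) \<in> Fin -` U} \<union> {t \<in> ?S'. 1 / t - a \<in> inf_chart -` U}"
  proof (intro equalityI subsetI)
    fix t assume "t \<in> {t. to_inf a (inf_chart t) \<in> U}"
    then show "t \<in> {t \<in> ?S. t / (1 - a * t) \<in> Fin -` U} \<union> {t \<in> ?S'. 1 / t - a \<in> inf_chart -` U}"
      by (cases "t = 0") (auto simp: to_inf_def inf_chart_def[of t] inf_chart_def[of 0])
  next
    fix t assume "t \<in> {t \<in> ?S. t / (1 - a * t) \<in> Fin -` U} \<union> {t \<in> ?S'. 1 / t - a \<in> inf_chart -` U}"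
    then consider "1 - a * t \<noteq> 0" "Fin (t / (1 - a * t)) \<in> U" | "t \<noteq> 0" "inf_chart (1 / t - a) \<in> U"
      by auto
    then show "t \<in> {t. to_inf a (inf_chart t) \<in> U}"
    proof cases
      case 1
      then show ?thesis by (simp add: to_inf_inf_chart)
    next
      case 2
      then show ?thesis by (simp add: to_inf_def inf_chart_def[of t])
    qed
  qed
  moreover have "open {t \<in> ?S. t / (1 - a * t) \<in> Fin -` U}"
    by (intro open_preimage open_affine_nonzero open_vimage_Fin U continuous_intros) auto
  moreover have "open {t \<in> ?S'. 1 / t - a \<in> inf_chart -` U}"
    by (intro open_preimage open_vimage_inf_chart U continuous_intros) auto
  ultimately show "open {t. to_inf a (inf_chart t) \<in> U}"
    by (simp only: open_Un)
qed

lemma continuous_from_inf: "continuous_on UNIV (from_inf a)"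
proof (rule continuous_on_cp1I)
  fix U :: "cp1 set" assume U: "open U"
  have "{t. from_inf a (inf_chart t) \<in> U} = {t. a + t \<in> Fin -` U}"
    by (auto simp: from_inf_def inf_chart_def)
  moreover have "open {t \<in> UNIV. a + t \<in> Fin -` U}"
    by (intro open_preimage open_vimage_Fin U continuous_intros open_UNIV)
  ultimately show "open {t. from_inf a (inf_chart t) \<in> U}"
    by simp
  let ?S = "{t. 1 + a * t \<noteq> 0}" and ?S' = "- {0} :: complex set"
  have "{t. from_inf a (Fin t) \<in> U} =
      {t \<in> ?S. t / (1 + a * t) \<in> inf_chart -` U} \<union> {t \<in> ?S'. a + 1 / t \<in> Fin -` U}"
  proof (intro equalityI subsetI)
    fix t assume "t \<in> {t. from_inf a (Fin t) \<in> U}"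
    then show "t \<in> {t \<in> ?S. t / (1 + a * t) \<in> inf_chart -` U} \<union> {t \<in> ?S'. a + 1 / t \<in> Fin -` U}"
      by (cases "t = 0") (auto simp: from_inf_def inf_chart_def)
  next
    fix t assume "t \<in> {t \<in> ?S. t / (1 + a * t) \<in> inf_chart -` U} \<union> {t \<in> ?S'. a + 1 / t \<in> Fin -` U}"
    then consider "1 + a * t \<noteq> 0" "inf_chart (t / (1 + a * t)) \<in> U" | "t \<noteq> 0" "Fin (a + 1 / t) \<in> U"
      by auto
    then show "t \<in> {t. from_inf a (Fin t) \<in> U}"
    proof cases
      case 1
      then show ?thesis by (simp add: from_inf_inf_chart)
    next
      case 2
      then show ?thesis by (simp add: from_inf_def)
    qed
  qed
  moreover have "open {t \<in> ?S. t / (1 + a * t) \<in> inf_chart -` U}"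
    by (intro open_preimage open_affine_nonzero open_vimage_inf_chart U continuous_intros) auto
  moreover have "open {t \<in> ?S'. a + 1 / t \<in> Fin -` U}"
    by (intro open_preimage open_vimage_Fin U continuous_intros) auto
  ultimately show "open {t. from_inf a (Fin t) \<in> U}"
    by (simp only: open_Un)
qed

lemma eventually_nhds_continuous:
  fixes h :: "'a::topological_space \<Rightarrow> 'b::topological_space"
  assumes "continuous_on UNIV h" "\<forall>\<^sub>F z in nhds (h x). P z"
  shows "\<forall>\<^sub>F y in nhds x. P (h y)"
proof -
  obtain U where U: "open U" "h x \<in> U" "\<And>z. z \<in> U \<Longrightarrow> P z"
    using assms(2) by (auto simp: eventually_nhds)
  have "open (h -` U)"
    using assms(1) U(1) by (simp add: continuous_on_open_vimage)
  then show ?thesis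
    using U by (auto simp: eventually_nhds intro!: exI[of _ "h -` U"])
qed

text \<open>For g = f o \<phi> the chain rule gives g' = f' \<phi>1 and g'' = f'' \<phi>1^2 + f'
  \<phi>2; the condition on \<open>c1\<close> is stated multiplied by \<phi>1, which avoids a
  division.\<close>

lemma ode_on_compose:
  assumes f: "ode_on b1 b2 V f" "open V" and S: "open S"
    and \<phi>: "\<And>w. w \<in> S \<Longrightarrow> \<phi> w \<in> V"
      "\<And>w. w \<in> S \<Longrightarrow> (\<phi> has_field_derivative \<phi>1 w) (at w)"
      "\<And>w. w \<in> S \<Longrightarrow> (\<phi>1 has_field_derivative \<phi>2 w) (at w)"
    and c: "\<And>w. w \<in> S \<Longrightarrow> c1 w * \<phi>1 w = b1 (\<phi> w) * (\<phi>1 w)\<^sup>2 - \<phi>2 w"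
      "\<And>w. w \<in> S \<Longrightarrow> c2 w = b2 (\<phi> w) * (\<phi>1 w)\<^sup>2"
    and g: "\<And>w. w \<in> S \<Longrightarrow> g w = f (\<phi> w)"
  shows "ode_on c1 c2 S g"
proof (rule ode_onI[OF S])
  fix w assume w: "w \<in> S"
  note D = ode_onD[OF f \<phi>(1)[OF w]]
  have "((\<lambda>w. f (\<phi> w)) has_field_derivative deriv f (\<phi> w) * \<phi>1 w) (at w)"
    by (rule DERIV_chain2[OF D(1) \<phi>(2)[OF w]])
  then show "(g has_field_derivative deriv f (\<phi> w) * \<phi>1 w) (at w)"
    by (rule has_field_derivative_transform_within_open[OF _ S w]) (simp add: g)
  show "((\<lambda>w. deriv f (\<phi> w) * \<phi>1 w) has_field_derivative
      (- b1 (\<phi> w) * deriv f (\<phi> w) - b2 (\<phi> w) * f (\<phi> w)) * \<phi>1 w * \<phi>1 w + \<phi>2 w * deriv f (\<phi> w)) (at w)"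
    by (rule DERIV_mult[OF DERIV_chain2[OF D(2) \<phi>(2)[OF w]] \<phi>(3)[OF w]])
  have "(- b1 (\<phi> w) * deriv f (\<phi> w) - b2 (\<phi> w) * f (\<phi> w)) * \<phi>1 w * \<phi>1 w + \<phi>2 w * deriv f (\<phi> w) +
      c1 w * (deriv f (\<phi> w) * \<phi>1 w) + c2 w * g w =
      (\<phi>2 w + c1 w * \<phi>1 w - b1 (\<phi> w) * (\<phi>1 w)\<^sup>2) * deriv f (\<phi> w)"
    by (simp add: c(2)[OF w] g[OF w] power2_eq_square algebra_simps)
  then show "(- b1 (\<phi> w) * deriv f (\<phi> w) - b2 (\<phi> w) * f (\<phi> w)) * \<phi>1 w * \<phi>1 w + \<phi>2 w * deriv f (\<phi> w) +
      c1 w * (deriv f (\<phi> w) * \<phi>1 w) + c2 w * g w = 0"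
    by (simp add: c(1)[OF w])
qed

text \<open>The coefficients in the coordinate \<open>w = 1/(z - a)\<close>; the values \<open>k\<close> at \<open>w = 0\<close> are those of the
  holomorphic extensions when infinity is an ordinary point.\<close>
definition coeff1_to_inf :: "complex \<Rightarrow> complex \<Rightarrow> (complex \<Rightarrow> complex) \<Rightarrow> complex \<Rightarrow> complex" where
  "coeff1_to_inf a k b1 w = (if w = 0 then k else 2 / w - b1 (a + 1 / w) / w\<^sup>2)"

definition coeff2_to_inf :: "complex \<Rightarrow> complex \<Rightarrow> (complex \<Rightarrow> complex) \<Rightarrow> complex \<Rightarrow> complex" where
  "coeff2_to_inf a k b2 w = (if w = 0 then k else b2 (a + 1 / w) / w ^ 4)"

lemma ode_on_to_inf:
  assumes "ode_on b1 b2 V f" "open V" "open S" "\<And>w. w \<in> S \<Longrightarrow> w \<noteq> 0 \<and> a + 1 / w \<in> V"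
    and "\<And>w. w \<in> S \<Longrightarrow> g w = f (a + 1 / w)"
  shows "ode_on (coeff1_to_inf a k b1) (coeff2_to_inf a k' b2) S g"
proof (rule ode_on_compose[OF assms(1-3), where \<phi> = "\<lambda>w. a + 1 / w" and ?\<phi>1.0 = "\<lambda>w. - 1 / w\<^sup>2"
      and ?\<phi>2.0 = "\<lambda>w. 2 / w ^ 3"])
  fix w assume w: "w \<in> S"
  then have "w \<noteq> 0" using assms(4) by auto
  then show "((\<lambda>w. a + 1 / w) has_field_derivative - 1 / w\<^sup>2) (at w)"
    by (auto intro!: derivative_eq_intros simp: power2_eq_square)
  show "((\<lambda>w. - 1 / w\<^sup>2) has_field_derivative 2 / w ^ 3) (at w)"
    using \<open>w \<noteq> 0\<close> by (auto intro!: derivative_eq_intros simp: power2_eq_square power3_eq_cube divide_simps)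
  show "coeff1_to_inf a k b1 w * (- 1 / w\<^sup>2) = b1 (a + 1 / w) * (- 1 / w\<^sup>2)\<^sup>2 - 2 / w ^ 3"
    using \<open>w \<noteq> 0\<close> by (simp add: coeff1_to_inf_def power2_eq_square power3_eq_cube field_simps)
  show "coeff2_to_inf a k' b2 w = b2 (a + 1 / w) * (- 1 / w\<^sup>2)\<^sup>2"
    using \<open>w \<noteq> 0\<close> by (simp add: coeff2_to_inf_def power2_eq_square power4_eq_xxxx)
qed (use assms in auto)

lemma ode_on_from_inf:
  assumes "ode_on (coeff1_to_inf a k b1) (coeff2_to_inf a k' b2) V f" "open V" "open S"
    and "\<And>z. z \<in> S \<Longrightarrow> z \<noteq> a \<and> 1 / (z - a) \<in> V"
    and "\<And>z. z \<in> S \<Longrightarrow> g z = f (1 / (z - a))"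
  shows "ode_on b1 b2 S g"
proof (rule ode_on_compose[OF assms(1-3), where \<phi> = "\<lambda>z. 1 / (z - a)" and ?\<phi>1.0 = "\<lambda>z. - 1 / (z - a)\<^sup>2"
      and ?\<phi>2.0 = "\<lambda>z. 2 / (z - a) ^ 3"])
  fix z assume z: "z \<in> S"
  then have ne: "z - a \<noteq> 0" using assms(4) by auto
  then show "((\<lambda>z. 1 / (z - a)) has_field_derivative - 1 / (z - a)\<^sup>2) (at z)"
    by (auto intro!: derivative_eq_intros simp: power2_eq_square)
  show "((\<lambda>z. - 1 / (z - a)\<^sup>2) has_field_derivative 2 / (z - a) ^ 3) (at z)"
    using ne by (auto intro!: derivative_eq_intros simp: power2_eq_square power3_eq_cube divide_simps)
  define w where "w = z - a"
  have w: "w \<noteq> 0" "z = a + w" using ne by (auto simp: w_def)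
  show "b1 z * (- 1 / (z - a)\<^sup>2) =
      coeff1_to_inf a k b1 (1 / (z - a)) * (- 1 / (z - a)\<^sup>2)\<^sup>2 - 2 / (z - a) ^ 3"
    using w(1) by (simp add: w(2) coeff1_to_inf_def power2_eq_square power3_eq_cube field_simps)
  show "b2 z = coeff2_to_inf a k' b2 (1 / (z - a)) * (- 1 / (z - a)\<^sup>2)\<^sup>2"
    using w(1) by (simp add: w(2) coeff2_to_inf_def power2_eq_square power4_eq_xxxx)
qed (use assms in auto)

text \<open>The delicate point is infinity when it is ordinary: it moves to w = 0, where the new
  equation must hold although the old one is imposed at finite z only. Continuity of the
  coefficients at 0 provides this.\<close>

lemma solution_transfer_to_inf:
  fixes a k1 k2 :: complex and b1 b2 :: "complex \<Rightarrow> complex"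
  defines "c1 \<equiv> coeff1_to_inf a k1 b1" and "c2 \<equiv> coeff2_to_inf a k2 b2"
  assumes a: "Fin a \<in> D" and cont: "Infty \<notin> D \<Longrightarrow> isCont c1 0" "Infty \<notin> D \<Longrightarrow> isCont c2 0"
  shows "solution_transfer D b1 b2 c1 c2 (to_inf a) (\<lambda>f. f \<circ> from_inf a)"
proof
  show "local_solution c1 c2 (to_inf a x) (f \<circ> from_inf a)"
    if xD: "x \<notin> D" and f: "local_solution b1 b2 x f" for x f
  proof (cases x)
    case (Fin z)
    obtain V where V: "open V" "z \<in> V" "ode_on b1 b2 V (\<lambda>z. f (Fin z))"
      using f by (auto simp: Fin local_solution_Fin)
    have "z \<noteq> a" using xD a Fin by auto
    let ?S = "{w \<in> - {0}. a + 1 / w \<in> V}"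
    have S: "open ?S"
      by (intro open_preimage V continuous_intros) auto
    have "ode_on c1 c2 ?S (\<lambda>w. (f \<circ> from_inf a) (Fin w))"
      unfolding c1_def c2_def by (rule ode_on_to_inf[OF V(3,1) S]) (auto simp: from_inf_def)
    moreover have "1 / (z - a) \<in> ?S"
      using V \<open>z \<noteq> a\<close> by simp
    moreover have "to_inf a x = Fin (1 / (z - a))"
      using \<open>z \<noteq> a\<close> by (simp add: Fin to_inf_def inf_chart_def)
    ultimately show ?thesis
      using S by (simp only: local_solution_Fin) blast
  next
    case Infty
    obtain U where U: "open U" "Infty \<in> U" "solution_on b1 b2 U f"
      using f by (auto simp: Infty local_solution_def)
    define g where "g w = (f \<circ> from_inf a) (Fin w)" for w
    define S where "S = {w \<in> {w. 1 + a * w \<noteq> 0}. w / (1 + a * w) \<in> inf_chart -` U}"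
    have S: "open S" "0 \<in> S"
    proof -
      show "open S"
        unfolding S_def
        by (intro open_preimage open_affine_nonzero open_vimage_inf_chart U continuous_intros) auto
      show "0 \<in> S"
        using U by (simp add: S_def inf_chart_def)
    qed
    have "((\<lambda>t. f (inf_chart t)) \<circ> (\<lambda>w. w / (1 + a * w))) holomorphic_on S"
      by (rule holomorphic_on_compose_gen[where t = "inf_chart -` U"])
        (use U(3) in \<open>auto simp: S_def solution_on_def holomorphic_cp1_def intro!: holomorphic_intros\<close>)
    then have g: "g holomorphic_on S"
      by (rule holomorphic_transform) (auto simp: g_def S_def from_inf_inf_chart)
    have V: "ode_on b1 b2 (Fin -` U) (\<lambda>z. f (Fin z))"
      using U(3) by (auto simp: ode_on_def solution_on_def holomorphic_cp1_def)
    have S': "open (S - {0})" using S by auto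
    have ode: "ode_on c1 c2 (S - {0}) g"
      unfolding c1_def c2_def
    proof (rule ode_on_to_inf[OF V open_vimage_Fin[OF U(1)] S'])
      fix w assume w: "w \<in> S - {0}"
      then have "from_inf a (Fin w) \<in> U"
        by (auto simp: S_def from_inf_inf_chart)
      with w show "w \<noteq> 0 \<and> a + 1 / w \<in> Fin -` U"
        by (auto simp: from_inf_def)
      show "g w = f (Fin (a + 1 / w))"
        using w by (simp add: g_def from_inf_def)
    qed
    \<comment> \<open>E vanishes on a punctured neighbourhood of 0 and is continuous at 0, so the
      equation extends to w = 0.\<close>
    define E where "E w = deriv (deriv g) w + c1 w * deriv g w + c2 w * g w" for w
    have cd: "isCont g 0" "isCont (deriv g) 0" "isCont (deriv (deriv g)) 0"
    proof -
      have "isCont h 0" if "h holomorphic_on S" for h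
        using holomorphic_on_imp_continuous_on[OF that] S by (simp add: continuous_on_eq_continuous_at)
      then show "isCont g 0" "isCont (deriv g) 0" "isCont (deriv (deriv g)) 0"
        using g S by (simp_all add: holomorphic_deriv)
    qed
    have "isCont E 0"
      unfolding E_def using cont xD Infty by (intro continuous_intros cd) auto
    then have "(E \<longlongrightarrow> E 0) (at 0)"
      by (simp add: isCont_def)
    moreover have "\<forall>\<^sub>F w in at 0. w \<in> S - {0}"
      using S by (simp add: eventually_at_filter eventually_nhds_in_open) (auto simp: eventually_nhds)
    then have "\<forall>\<^sub>F w in at 0. E w = 0"
      by eventually_elim (use ode in \<open>auto simp: ode_on_def E_def\<close>)
    then have "(E \<longlongrightarrow> 0) (at 0)"
      by (rule tendsto_eventually)
    ultimately have "E 0 = 0"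
      using tendsto_unique[of "at (0::complex)" E] by auto
    then have "ode_on c1 c2 S g"
      using ode g unfolding ode_on_def E_def by blast
    then show ?thesis
      using S by (auto simp: Infty to_inf_def local_solution_Fin g_def[abs_def])
  qed
  show "\<forall>\<^sub>F w in nhds (to_inf a x). (f \<circ> from_inf a) w = (g \<circ> from_inf a) w"
    if "\<forall>\<^sub>F z in nhds x. f z = g z" for x f g
    using eventually_nhds_continuous[OF continuous_from_inf, of "\<lambda>z. f z = g z" a "to_inf a x"] that by simp
  show "\<forall>\<^sub>F z in nhds x. f z = 0" if "\<forall>\<^sub>F w in nhds (to_inf a x). (f \<circ> from_inf a) w = 0" for x and f :: "cp1 \<Rightarrow> complex"
    using eventually_nhds_continuous[OF continuous_to_inf that] by simp
  show "\<exists>f. local_solution b1 b2 x f \<and> (\<forall>\<^sub>F w in nhds (to_inf a x). (f \<circ> from_inf a) w = h w)"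
    if xD: "x \<notin> D" and h: "local_solution c1 c2 (to_inf a x) h" for x h
  proof (intro exI conjI)
    show "\<forall>\<^sub>F w in nhds (to_inf a x). ((h \<circ> to_inf a) \<circ> from_inf a) w = h w"
      by simp
    \<comment> \<open>Only a is sent to infinity, and a is singular.\<close>
    have "\<exists>w. to_inf a x = Fin w"
      using xD a by (cases x) (auto simp: to_inf_def inf_chart_def)
    then obtain w where w: "to_inf a x = Fin w" ..
    obtain V where V: "open V" "w \<in> V" "ode_on c1 c2 V (\<lambda>z. h (Fin z))"
      using h by (auto simp: w local_solution_Fin)
    define U where "U = to_inf a -` (Fin ` V)"
    have U: "open U"
      using continuous_to_inf open_image_Fin[OF V(1)] by (simp add: U_def continuous_on_open_vimage)
    have "ode_on b1 b2 (Fin -` U) (\<lambda>z. (h \<circ> to_inf a) (Fin z))"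
      by (rule ode_on_from_inf[OF V(3)[unfolded c1_def c2_def] V(1) open_vimage_Fin[OF U]])
        (auto simp: U_def to_inf_def inf_chart_def split: if_splits)
    moreover have "(\<lambda>t. (h \<circ> to_inf a) (inf_chart t)) holomorphic_on inf_chart -` U"
    proof -
      have V': "1 - a * t \<noteq> 0 \<and> t / (1 - a * t) \<in> V" if t: "t \<in> inf_chart -` U" for t
      proof -
        \<comment> \<open>If a t = 1, then t represents the point a, whose image is infinite and so
          outside the image of V.\<close>
        have "1 - a * t \<noteq> 0"
          using t by (cases "t = 0") (auto simp: U_def to_inf_def inf_chart_def field_simps split: if_splits)
        then show ?thesis
          using t by (auto simp: U_def to_inf_inf_chart)
      qed
      have "((\<lambda>z. h (Fin z)) \<circ> (\<lambda>t. t / (1 - a * t))) holomorphic_on inf_chart -` U"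
      proof (rule holomorphic_on_compose_gen[where t = V])
        show "(\<lambda>t. t / (1 - a * t)) holomorphic_on inf_chart -` U"
          using V' by (intro holomorphic_intros) auto
        show "(\<lambda>z. h (Fin z)) holomorphic_on V"
          using V(3) by (simp add: ode_on_def)
      qed (use V' in blast)
      then show ?thesis
        by (rule holomorphic_transform) (use V' to_inf_inf_chart in auto)
    qed
    ultimately have "solution_on b1 b2 U (h \<circ> to_inf a)"
      by (auto simp: solution_on_def holomorphic_cp1_def ode_on_def)
    moreover have "x \<in> U"
      using w V by (auto simp: U_def)
    ultimately show "local_solution b1 b2 x (h \<circ> to_inf a)"
      using U unfolding local_solution_def by blast
  qed
qed (auto simp: o_def)


section \<open>The Riemann conditions in the coordinate \<open>w = 1/(z - a)\<close>\<close>

lemma analytic_at_compose: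
  assumes "\<phi> analytic_on {w}" "g analytic_on {\<phi> w}"
  shows "(\<lambda>w. g (\<phi> w)) analytic_on {w}"
  using analytic_on_compose[of \<phi> "{w}" g] assms by (simp add: o_def)

text \<open>With e' = 1/(e - a) and z = a + 1/w one has w - e' = - (z - e) w e', so the factors
  clearing the poles correspond up to functions nonzero at e'.\<close>

lemma pole_order_to_inf:
  assumes e: "e \<noteq> a"
  shows "pole_order_at_most b1 e 1 \<Longrightarrow> pole_order_at_most (coeff1_to_inf a k b1) (1 / (e - a)) 1"
    and "pole_order_at_most b2 e 2 \<Longrightarrow> pole_order_at_most (coeff2_to_inf a k b2) (1 / (e - a)) 2"
proof -
  define e' where "e' = 1 / (e - a)"
  have e': "e' \<noteq> 0" "a + 1 / e' = e"
    using e by (auto simp: e'_def)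
  have inj: "a + 1 / w \<noteq> e" if "w \<noteq> 0" "w \<noteq> e'" for w
    using that e' by auto
  have ne: "\<forall>\<^sub>F w in at e'. w \<noteq> 0" "\<forall>\<^sub>F w in at e'. w \<noteq> e'"
    using e' by (auto intro: eventually_neq_at_within)
  have "((\<lambda>w. a + 1 / w) \<longlongrightarrow> a + 1 / e') (at e')"
    using e' by (intro tendsto_intros)
  moreover have "\<forall>\<^sub>F w in at e'. a + 1 / w \<noteq> e"
    using ne by eventually_elim (rule inj)
  ultimately have lim: "filterlim (\<lambda>w. a + 1 / w) (at e) (at e')"
    by (simp add: filterlim_at e')
  have \<phi>: "(\<lambda>w. g (a + 1 / w)) analytic_on {e'}" if "g analytic_on {e}" for g
    using that e' by - (rule analytic_at_compose[of "\<lambda>w. a + 1 / w"], (intro analytic_intros)?, auto)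
  have diff: "w - e' = - (a + 1 / w - e) * w * e'" if "w \<noteq> 0" for w
  proof -
    have "a + 1 / w - e = 1 / w - 1 / e'"
      using e'(2) by (simp add: algebra_simps)
    then show ?thesis
      using that e'(1) by (simp add: field_simps)
  qed
  show "pole_order_at_most (coeff1_to_inf a k b1) (1 / (e - a)) 1" if b1: "pole_order_at_most b1 e 1"
  proof -
    obtain g where g: "g analytic_on {e}" "\<forall>\<^sub>F z in at e. (z - e) ^ 1 * b1 z = g z"
      using b1 by (auto simp: pole_order_at_most_def)
    have "\<forall>\<^sub>F w in at e'. (a + 1 / w - e) ^ 1 * b1 (a + 1 / w) = g (a + 1 / w)"
      by (rule eventually_compose_filterlim[OF g(2) lim])
    then have "\<forall>\<^sub>F w in at e'. (w - e') ^ 1 * coeff1_to_inf a k b1 w = (2 * (w - e') + e' * g (a + 1 / w)) / w"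
      using ne(1)
    proof eventually_elim
      case (elim w)
      have "- (v - e) * w * e' * u = - w * e' * ((v - e) ^ 1 * u)" for u v
        by (simp add: algebra_simps)
      then have "(w - e') * b1 (a + 1 / w) = - w * e' * g (a + 1 / w)"
        unfolding diff[OF elim(2)] elim(1)[symmetric] .
      then have "(w - e') * coeff1_to_inf a k b1 w = 2 * (w - e') / w - (- w * e' * g (a + 1 / w)) / w\<^sup>2"
        using elim(2) by (simp add: coeff1_to_inf_def right_diff_distrib)
      then show ?case
        using elim(2) by (simp add: add_divide_distrib power2_eq_square)
    qed
    moreover have "(\<lambda>w. (2 * (w - e') + e' * g (a + 1 / w)) / w) analytic_on {e'}"
      using e'(1) by (intro analytic_intros \<phi>[OF g(1)]) auto
    ultimately show ?thesis
      unfolding e'_def[symmetric] by (intro pole_order_at_mostI)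
  qed
  show "pole_order_at_most (coeff2_to_inf a k b2) (1 / (e - a)) 2" if b2: "pole_order_at_most b2 e 2"
  proof -
    obtain g where g: "g analytic_on {e}" "\<forall>\<^sub>F z in at e. (z - e) ^ 2 * b2 z = g z"
      using b2 by (auto simp: pole_order_at_most_def)
    have "\<forall>\<^sub>F w in at e'. (a + 1 / w - e) ^ 2 * b2 (a + 1 / w) = g (a + 1 / w)"
      by (rule eventually_compose_filterlim[OF g(2) lim])
    then have "\<forall>\<^sub>F w in at e'. (w - e') ^ 2 * coeff2_to_inf a k b2 w = e'\<^sup>2 * g (a + 1 / w) / w\<^sup>2"
      using ne(1)
    proof eventually_elim
      case (elim w)
      have "(w - e')\<^sup>2 * b2 (a + 1 / w) = w\<^sup>2 * e'\<^sup>2 * g (a + 1 / w)"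
        unfolding diff[OF elim(2)] elim(1)[symmetric] by (simp add: power_mult_distrib power2_commute[of e])
      then show ?case
        using elim(2) by (simp add: coeff2_to_inf_def power2_eq_square power4_eq_xxxx)
    qed
    moreover have "(\<lambda>w. e'\<^sup>2 * g (a + 1 / w) / w\<^sup>2) analytic_on {e'}"
      using e'(1) by (intro analytic_intros \<phi>[OF g(1)]) auto
    ultimately show ?thesis
      unfolding e'_def[symmetric] by (intro pole_order_at_mostI)
  qed
qed

lemma pole_order_shift:
  assumes "pole_order_at_most f a k" "\<And>t. t \<noteq> 0 \<Longrightarrow> g t = f (a + t)"
  shows "pole_order_at_most g 0 k"
proof -
  obtain h where h: "h analytic_on {a}" "\<forall>\<^sub>F z in at a. (z - a) ^ k * f z = h z"
    using assms(1) by (auto simp: pole_order_at_most_def)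
  have "filterlim (\<lambda>t. a + t) (at a) (at 0)"
    unfolding filterlim_at by (auto intro!: tendsto_eq_intros simp: eventually_at_filter)
  then have "\<forall>\<^sub>F t in at 0. (a + t - a) ^ k * f (a + t) = h (a + t)"
    by (rule eventually_compose_filterlim[OF h(2)])
  moreover have "\<forall>\<^sub>F t in at (0::complex). t \<noteq> 0"
    by (simp add: eventually_at_filter)
  ultimately have "\<forall>\<^sub>F t in at 0. (t - 0) ^ k * g t = h (a + t)"
    by eventually_elim (simp add: assms(2))
  moreover have "(\<lambda>t. h (a + t)) analytic_on {0}"
    using h(1) by - (rule analytic_at_compose[of "\<lambda>t. a + t"], (intro analytic_intros)?, auto)
  ultimately show ?thesis
    by (intro pole_order_at_mostI)
qed

text \<open>Near the old infinity t = 1/z = w/(1 + a w) is a regular change of coordinate. The term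
  2 a/(1 + a w) reflects its second derivative; the required k is the value at 0 of the
  extension.\<close>

lemma analytic_at_0_to_inf:
  assumes "pole_order_at_most (inf_coeff1 b1) 0 0" "pole_order_at_most (inf_coeff2 b2) 0 0"
  shows "\<exists>k. coeff1_to_inf a k b1 analytic_on {0}" "\<exists>k. coeff2_to_inf a k b2 analytic_on {0}"
proof -
  obtain g1 g2 where g1: "g1 analytic_on {0}" "\<forall>\<^sub>F t in at 0. inf_coeff1 b1 t = g1 t"
    and g2: "g2 analytic_on {0}" "\<forall>\<^sub>F t in at 0. inf_coeff2 b2 t = g2 t"
    using assms by (auto simp: pole_order_at_most_def)
  define t where "t w = w / (1 + a * w)" for w
  have ne0: "\<forall>\<^sub>F w in at (0::complex). w \<noteq> 0"
    by (simp add: eventually_at_filter)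
  have "((\<lambda>w. 1 + a * w) \<longlongrightarrow> 1 + a * 0) (at 0)"
    by (intro tendsto_intros)
  then have ne: "\<forall>\<^sub>F w in at 0. 1 + a * w \<noteq> 0"
    by (rule tendsto_imp_eventually_ne) simp
  have "(t \<longlongrightarrow> 0 / (1 + a * 0)) (at 0)"
    unfolding t_def by (intro tendsto_intros) auto
  moreover have "\<forall>\<^sub>F w in at 0. t w \<noteq> 0"
    using ne0 ne by eventually_elim (simp add: t_def)
  ultimately have lim: "filterlim t (at 0) (at 0)"
    by (simp add: filterlim_at)
  have \<phi>: "(\<lambda>w. g (t w)) analytic_on {0}" if "g analytic_on {0}" for g
    using that unfolding t_def by - (rule analytic_at_compose[of "\<lambda>w. w / (1 + a * w)"], (intro analytic_intros)?, auto)
  show "\<exists>k. coeff1_to_inf a k b1 analytic_on {0}"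
  proof
    define h where "h w = 2 * a / (1 + a * w) + g1 (t w) / (1 + a * w)\<^sup>2" for w
    have "\<forall>\<^sub>F w in at 0. coeff1_to_inf a (h 0) b1 w = h w"
      using ne0 ne eventually_compose_filterlim[OF g1(2) lim]
    proof eventually_elim
      case (elim w)
      define u where "u = 1 + a * w"
      have t: "1 / t w = a + 1 / w" "t w = w / u"
        using elim by (simp_all add: t_def u_def add_divide_distrib)
      have "b1 (a + 1 / w) = (t w)\<^sup>2 * (2 / t w - g1 (t w))"
        unfolding elim(3)[symmetric] inf_coeff1_def t(1) using elim by (simp add: t_def)
      then have "coeff1_to_inf a (h 0) b1 w = 2 / w - (w / u)\<^sup>2 * (2 / (w / u) - g1 (t w)) / w\<^sup>2"
        using elim(1) by (simp add: coeff1_to_inf_def t(2))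
      also have "\<dots> = 2 / w - 2 / (w * u) + g1 (t w) / u\<^sup>2"
        using elim by (simp add: u_def[symmetric] power2_eq_square right_diff_distrib diff_divide_distrib)
      also have "2 / w - 2 / (w * u) = 2 * a / u"
        using elim by (simp add: u_def divide_simps)
      finally show ?case
        by (simp add: h_def u_def)
    qed
    then have ev: "\<forall>\<^sub>F w in nhds 0. coeff1_to_inf a (h 0) b1 w = h w"
      by (simp add: eventually_nhds_conv_at coeff1_to_inf_def)
    have "h analytic_on {0}"
      unfolding h_def by (intro analytic_intros \<phi>[OF g1(1)]) auto
    then show "coeff1_to_inf a (h 0) b1 analytic_on {0}"
      using analytic_at_cong[OF ev refl] by simp
  qed
  show "\<exists>k. coeff2_to_inf a k b2 analytic_on {0}"
  proof
    define h where "h w = g2 (t w) / (1 + a * w) ^ 4" for w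
    have "\<forall>\<^sub>F w in at 0. coeff2_to_inf a (h 0) b2 w = h w"
      using ne0 ne eventually_compose_filterlim[OF g2(2) lim]
    proof eventually_elim
      case (elim w)
      have t: "1 / t w = a + 1 / w"
        using elim by (simp add: t_def field_simps)
      show ?case
        unfolding h_def elim(3)[symmetric] inf_coeff2_def t
        using elim by (simp add: coeff2_to_inf_def t_def power_divide)
    qed
    then have ev: "\<forall>\<^sub>F w in nhds 0. coeff2_to_inf a (h 0) b2 w = h w"
      by (simp add: eventually_nhds_conv_at coeff2_to_inf_def)
    have "h analytic_on {0}"
      unfolding h_def by (intro analytic_intros \<phi>[OF g2(1)]) auto
    then show "coeff2_to_inf a (h 0) b2 analytic_on {0}"
      using analytic_at_cong[OF ev refl] by simp
  qed
qed

lemma to_inf_image: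
  assumes "b \<noteq> a" "c \<noteq> a"
  shows "to_inf a ` {Fin a, Fin b, Fin c} = {Fin (1 / (b - a)), Fin (1 / (c - a)), Infty}"
  using assms by (auto simp: to_inf_def inf_chart_def)

text \<open>Four kinds of points occur: w = 0 is the old ordinary infinity, b' and c' come from b
  and c, the new infinity comes from a, and any other w from an ordinary finite point.\<close>

lemma riemann_equation_to_inf:
  assumes ne: "b \<noteq> a" "c \<noteq> a" "b \<noteq> c" and eq: "riemann_equation {Fin a, Fin b, Fin c} b1 b2"
  obtains k1 k2 where
    "riemann_equation {Fin (1 / (b - a)), Fin (1 / (c - a)), Infty} (coeff1_to_inf a k1 b1) (coeff2_to_inf a k2 b2)"
    "isCont (coeff1_to_inf a k1 b1) 0" "isCont (coeff2_to_inf a k2 b2) 0"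
proof -
  have D: "{z. Fin z \<notin> {Fin a, Fin b, Fin c}} = - {a, b, c}"
    by auto
  have hol: "b1 holomorphic_on - {a, b, c}" "b2 holomorphic_on - {a, b, c}"
    and pole: "\<And>e. e \<in> {a, b, c} \<Longrightarrow> pole_order_at_most b1 e 1 \<and> pole_order_at_most b2 e 2"
    and inf: "pole_order_at_most (inf_coeff1 b1) 0 0" "pole_order_at_most (inf_coeff2 b2) 0 0"
    using eq by (auto simp: riemann_equation_def D)
  obtain k1 k2 where k: "coeff1_to_inf a k1 b1 analytic_on {0}" "coeff2_to_inf a k2 b2 analytic_on {0}"
    using analytic_at_0_to_inf[OF inf] by blast
  define b' c' where "b' = 1 / (b - a)" and "c' = 1 / (c - a)"
  have D': "{z. Fin z \<notin> {Fin b', Fin c', Infty}} = - {b', c'}"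
    by auto
  have ana: "coeff1_to_inf a k1 b1 analytic_on {w}" "coeff2_to_inf a k2 b2 analytic_on {w}"
    if w: "w \<in> - {b', c'}" for w
  proof -
    have "coeff1_to_inf a k1 b1 analytic_on {w} \<and> coeff2_to_inf a k2 b2 analytic_on {w}"
    proof (cases "w = 0")
      case False
      have z: "a + 1 / w \<in> - {a, b, c}"
        using w False ne by (auto simp: b'_def c'_def field_simps)
      have op: "open (- {a, b, c})" by auto
      have \<phi>: "(\<lambda>w. g (a + 1 / w)) analytic_on {w}" if g: "g holomorphic_on - {a, b, c}" for g
      proof -
        have "g analytic_on {a + 1 / w}"
          by (rule holomorphic_on_imp_analytic_at[OF g op z])
        then show ?thesis
          using False by - (rule analytic_at_compose[of "\<lambda>w. a + 1 / w"], (intro analytic_intros)?, auto)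
      qed
      have "\<forall>\<^sub>F v in nhds w. v \<in> - {0}"
        using False by (intro eventually_nhds_in_open) auto
      then have ev: "\<forall>\<^sub>F v in nhds w. coeff1_to_inf a k1 b1 v = 2 / v - b1 (a + 1 / v) / v\<^sup>2"
        "\<forall>\<^sub>F v in nhds w. coeff2_to_inf a k2 b2 v = b2 (a + 1 / v) / v ^ 4"
        by (eventually_elim, simp add: coeff1_to_inf_def coeff2_to_inf_def)+
      have "(\<lambda>v. 2 / v - b1 (a + 1 / v) / v\<^sup>2) analytic_on {w}" "(\<lambda>v. b2 (a + 1 / v) / v ^ 4) analytic_on {w}"
        using False by (auto intro!: analytic_intros \<phi>[OF hol(1)] \<phi>[OF hol(2)])
      then show ?thesis
        using analytic_at_cong[OF ev(1) refl] analytic_at_cong[OF ev(2) refl] by simp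
    qed (use k in simp)
    then show "coeff1_to_inf a k1 b1 analytic_on {w}" "coeff2_to_inf a k2 b2 analytic_on {w}"
      by auto
  qed
  have "coeff1_to_inf a k1 b1 analytic_on - {b', c'}" "coeff2_to_inf a k2 b2 analytic_on - {b', c'}"
    using ana by (subst analytic_on_analytic_at; blast)+
  then have hol': "coeff1_to_inf a k1 b1 holomorphic_on - {b', c'}" "coeff2_to_inf a k2 b2 holomorphic_on - {b', c'}"
    by (auto intro: analytic_imp_holomorphic)
  \<comment> \<open>In t = 1/w = z - a the transformed equation is the original one translated, with
    coefficients b1(a + t) and b2(a + t).\<close>
  have inf1: "pole_order_at_most (inf_coeff1 (coeff1_to_inf a k1 b1)) 0 1"
    by (rule pole_order_shift[of b1 a])
      (use pole in \<open>auto simp: inf_coeff1_def coeff1_to_inf_def diff_divide_distrib power2_eq_square\<close>)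
  have inf2: "pole_order_at_most (inf_coeff2 (coeff2_to_inf a k2 b2)) 0 2"
    by (rule pole_order_shift[of b2 a])
      (use pole in \<open>auto simp: inf_coeff2_def coeff2_to_inf_def power_divide\<close>)
  have "card {Fin b', Fin c', Infty} = 3"
    using ne by (simp add: b'_def c'_def)
  moreover have "pole_order_at_most (coeff1_to_inf a k1 b1) e 1 \<and> pole_order_at_most (coeff2_to_inf a k2 b2) e 2"
    if "e \<in> {b', c'}" for e
    using that pole_order_to_inf[OF ne(1), of b1 k1 ] pole_order_to_inf(2)[OF ne(1), of b2 k2]
      pole_order_to_inf[OF ne(2), of b1 k1] pole_order_to_inf(2)[OF ne(2), of b2 k2] pole
    by (auto simp: b'_def c'_def)
  ultimately have "riemann_equation {Fin b', Fin c', Infty} (coeff1_to_inf a k1 b1) (coeff2_to_inf a k2 b2)"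
    using hol' inf1 inf2 by (simp add: riemann_equation_def D' del: insert_iff) auto
  then show ?thesis
    using k analytic_at_imp_isCont by (intro that[of k1 k2]) (auto simp: b'_def c'_def)
qed


section \<open>Transport of fundamental groups\<close>

lemma homotopy_class_eq:
  assumes "homotopic_paths S p q"
  shows "homotopy_class S p = homotopy_class S q"
proof -
  have "homotopic_paths S p r \<longleftrightarrow> homotopic_paths S q r" for r
    using assms by (metis homotopic_paths_trans homotopic_paths_sym)
  then show ?thesis
    by (simp add: homotopy_class_def)
qed

lemma homotopy_class_self: "p \<in> loops S x \<Longrightarrow> p \<in> homotopy_class S p"
  by (auto simp: homotopy_class_def loops_def)

text \<open>Homotopic representatives have homotopic images, so all members of the union in
  \<open>induced_map\<close> coincide.\<close>

lemma induced_map_homotopy_class: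
  assumes "p \<in> loops S x" "continuous_on S f" "f ` S \<subseteq> T"
  shows "induced_map f T (homotopy_class S p) = homotopy_class T (f \<circ> p)"
proof -
  have "homotopy_class T (f \<circ> q) = homotopy_class T (f \<circ> p)" if "q \<in> homotopy_class S p" for q
  proof (rule homotopy_class_eq[symmetric], rule homotopic_paths_continuous_image)
    show "homotopic_paths S p q"
      using that by (simp add: homotopy_class_def)
  qed (use assms in auto)
  then have "induced_map f T (homotopy_class S p) = (\<Union>q\<in>homotopy_class S p. homotopy_class T (f \<circ> p))"
    by (simp add: induced_map_def)
  then show ?thesis
    using homotopy_class_self[OF assms(1)] by auto
qed

lemma loops_compose:
  assumes "p \<in> loops S x" "continuous_on S f" "f ` S \<subseteq> T"
  shows "f \<circ> p \<in> loops T (f x)"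
proof -
  have p: "path p" "path_image p \<subseteq> S" "pathstart p = x" "pathfinish p = x"
    using assms(1) by (auto simp: loops_def)
  have "path (f \<circ> p)"
    using p(1) continuous_on_subset[OF assms(2) p(2)] by (rule path_continuous_image)
  then show ?thesis
    using p assms(3) by (auto simp: loops_def path_image_compose pathstart_compose pathfinish_compose)
qed

lemma loops_join: "p \<in> loops S x \<Longrightarrow> q \<in> loops S x \<Longrightarrow> p +++ q \<in> loops S x"
  by (auto simp: loops_def path_image_join)

lemma fundamental_group_mult:
  assumes "p \<in> loops S x" "q \<in> loops S x"
  shows "homotopy_class S p \<otimes>\<^bsub>fundamental_group S x\<^esub> homotopy_class S q = homotopy_class S (p +++ q)"
proof -
  have "homotopy_class S (p' +++ q') = homotopy_class S (p +++ q)"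
    if "p' \<in> homotopy_class S p" "q' \<in> homotopy_class S q" for p' q'
    by (rule homotopy_class_eq[symmetric], rule homotopic_paths_join)
      (use that assms in \<open>auto simp: homotopy_class_def loops_def\<close>)
  then have "(\<Union>p'\<in>homotopy_class S p. \<Union>q'\<in>homotopy_class S q. homotopy_class S (p' +++ q')) =
      (\<Union>p'\<in>homotopy_class S p. \<Union>q'\<in>homotopy_class S q. homotopy_class S (p +++ q))"
    by simp
  also have "\<dots> = homotopy_class S (p +++ q)"
    using homotopy_class_self[OF assms(1)] homotopy_class_self[OF assms(2)] by auto
  finally show ?thesis
    by (simp add: fundamental_group_def)
qed

lemma induced_map_hom:
  assumes "continuous_on S f" "f ` S \<subseteq> T"
  shows "induced_map f T \<in> hom (fundamental_group S x) (fundamental_group T (f x))"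
proof (rule homI)
  fix A assume "A \<in> carrier (fundamental_group S x)"
  then obtain p where "p \<in> loops S x" "A = homotopy_class S p"
    by (auto simp: fundamental_group_def)
  then show "induced_map f T A \<in> carrier (fundamental_group T (f x))"
    using assms loops_compose[OF _ assms, of p x]
    by (simp add: induced_map_homotopy_class[OF _ assms] fundamental_group_def)
next
  fix A B assume "A \<in> carrier (fundamental_group S x)" "B \<in> carrier (fundamental_group S x)"
  then obtain p q where p: "p \<in> loops S x" "A = homotopy_class S p"
    and q: "q \<in> loops S x" "B = homotopy_class S q"
    by (auto simp: fundamental_group_def)
  show "induced_map f T (A \<otimes>\<^bsub>fundamental_group S x\<^esub> B) =
      induced_map f T A \<otimes>\<^bsub>fundamental_group T (f x)\<^esub> induced_map f T B"
    unfolding p(2) q(2) fundamental_group_mult[OF p(1) q(1)]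
      induced_map_homotopy_class[OF p(1) assms] induced_map_homotopy_class[OF q(1) assms]
      induced_map_homotopy_class[OF loops_join[OF p(1) q(1)] assms] path_compose_join
      fundamental_group_mult[OF loops_compose[OF p(1) assms] loops_compose[OF q(1) assms]] ..
qed

theorem theorem2p1:
  fixes a1 a2 a3 x :: cp1
    and D :: "cp1 set"
    and \<rho> :: "(real \<Rightarrow> cp1) set \<Rightarrow> complex^2^2"
  assumes "distinct [a1, a2, a3]"
    and "D = {a1, a2, a3}"
    and "x \<notin> D"
    and "\<rho> \<in> hom (fundamental_group (- D) x) SL2"
    and "\<exists>b1 b2. riemann_equation D b1 b2 \<and> monodromy_representation D b1 b2 x \<rho>"
  shows "\<exists>m q \<sigma>.
           moebius_transformation m \<and>
           Infty \<in> m ` D \<and>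
           riemann_sturm_liouville_equation (m ` D) q \<and>
           \<sigma> \<in> hom (fundamental_group (- (m ` D)) (m x)) SL2 \<and>
           monodromy_representation (m ` D) (\<lambda>_. 0) q (m x) \<sigma> \<and>
           (\<forall>A \<in> carrier (fundamental_group (- D) x). \<rho> A = \<sigma> (induced_map m (- (m ` D)) A))"
proof -
  obtain b1 b2 where eq: "riemann_equation D b1 b2" and rep: "monodromy_representation D b1 b2 x \<rho>"
    using assms(5) by blast
  have reduce: "\<exists>q. riemann_sturm_liouville_equation D' q \<and> monodromy_representation D' (\<lambda>_. 0) q y \<sigma>"
    if D': "D' = {Fin a, Fin b, Infty}" "a \<noteq> b" "y \<notin> D'"
      and hom: "\<sigma> \<in> hom (fundamental_group (- D') y) SL2"
      and eq: "riemann_equation D' c1 c2" and rep: "monodromy_representation D' c1 c2 y \<sigma>"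
    for D' a b y c1 c2 \<sigma>
  proof -
    have "det (\<sigma> (homotopy_class (- D') \<gamma>)) = 1" if "\<gamma> \<in> loops (- D') y" for \<gamma>
    proof -
      have "homotopy_class (- D') \<gamma> \<in> carrier (fundamental_group (- D') y)"
        using that by (simp add: fundamental_group_def)
      then have "\<sigma> (homotopy_class (- D') \<gamma>) \<in> carrier SL2"
        using hom by (auto simp: hom_def)
      then show ?thesis
        by (simp add: SL2_def)
    qed
    then show ?thesis
      using sturm_liouville_if_infinity_singular[of a b y c1 c2 \<sigma>] that by blast
  qed
  show ?thesis
  proof (cases "Infty \<in> D")
    case True
    then obtain a b where ab: "D = {Fin a, Fin b, Infty}" "a \<noteq> b"
      using assms(1,2) by (cases a1; cases a2; cases a3) auto
    obtain q where q: "riemann_sturm_liouville_equation D q" "monodromy_representation D (\<lambda>_. 0) q x \<rho>"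
      using reduce[OF ab assms(3,4) eq rep] by blast
    \<comment> \<open>Infinity is already singular, so m is the identity and \<sigma> =
      \<rho>.\<close>
    have id: "moebius_map 1 0 0 1 = id"
      by (auto simp: moebius_map_def moebius_def fun_eq_iff split: cp1.splits)
    have "moebius_transformation id"
      unfolding moebius_transformation_def by (intro exI[of _ 1] exI[of _ 0]) (simp add: id)
    moreover have "\<rho> A = \<rho> (induced_map id (- D) A)" if A: "A \<in> carrier (fundamental_group (- D) x)" for A
    proof -
      obtain p where p: "p \<in> loops (- D) x" "A = homotopy_class (- D) p"
        using A by (auto simp: fundamental_group_def)
      have "induced_map id (- D) A = A"
        unfolding p(2) by (subst induced_map_homotopy_class[OF p(1)]) auto
      then show ?thesis by simp
    qed
    ultimately show ?thesis
      using q True assms(4) by (intro exI[of _ id] exI[of _ q] exI[of _ \<rho>]) auto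
  next
    case False
    then obtain a b c where abc: "D = {Fin a, Fin b, Fin c}" "b \<noteq> a" "c \<noteq> a" "b \<noteq> c"
      using assms(1,2) by (cases a1; cases a2; cases a3) auto
    define m n where "m = to_inf a" and "n = from_inf a"
    have inv: "n (m y) = y" "m (n y) = y" for y
      by (simp_all add: m_def n_def)
    define b' c' where "b' = 1 / (b - a)" and "c' = 1 / (c - a)"
    have mD: "m ` D = {Fin b', Fin c', Infty}"
      using to_inf_image[OF abc(2,3)] by (simp add: abc(1) m_def b'_def c'_def)
    have "b' \<noteq> c'"
      using abc by (simp add: b'_def c'_def)
    obtain k1 k2 where k: "riemann_equation (m ` D) (coeff1_to_inf a k1 b1) (coeff2_to_inf a k2 b2)"
      "isCont (coeff1_to_inf a k1 b1) 0" "isCont (coeff2_to_inf a k2 b2) 0"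
      using riemann_equation_to_inf[OF abc(2-4) eq[unfolded abc(1)]] unfolding mD b'_def c'_def by blast
    interpret solution_transfer D b1 b2 "coeff1_to_inf a k1 b1" "coeff2_to_inf a k2 b2" m "\<lambda>f. f \<circ> n"
      unfolding m_def n_def by (rule solution_transfer_to_inf) (use abc k in auto)
    have cont: "continuous_on S m" "continuous_on S n" for S
      using continuous_to_inf continuous_from_inf by (auto simp: m_def n_def intro: continuous_on_subset)
    have img: "m ` (- D) \<subseteq> - m ` D" "n ` (- m ` D) \<subseteq> - D"
    proof -
      show "m ` (- D) \<subseteq> - m ` D"
        using inv(1) by (auto, metis)
      show "n ` (- m ` D) \<subseteq> - D"
      proof clarify
        fix y assume "y \<notin> m ` D" "n y \<in> D"
        then show False
          using imageI[of "n y" D m] by (simp add: inv)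
      qed
    qed
    \<comment> \<open>The representation is carried over by the inverse n of m, which makes \<rho> =
      \<sigma> o m* immediate on homotopy classes.\<close>
    define \<sigma> where "\<sigma> A = \<rho> (induced_map n (- D) A)" for A
    have "\<sigma> = \<rho> \<circ> induced_map n (- D)"
      by (simp add: fun_eq_iff \<sigma>_def)
    then have \<sigma>: "\<sigma> \<in> hom (fundamental_group (- m ` D) (m x)) SL2"
      using hom_compose[OF induced_map_hom[OF cont(2) img(2), of "m x"]] assms(4) by (simp add: inv)
    obtain Y where Y: "solution_basis b1 b2 x Y"
      and mono: "\<And>\<gamma>. \<gamma> \<in> loops (- D) x \<Longrightarrow> monodromy_matrix b1 b2 Y \<gamma> (\<rho> (homotopy_class (- D) \<gamma>))"
      using rep by (auto simp: monodromy_representation_def)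
    have "monodromy_matrix (coeff1_to_inf a k1 b1) (coeff2_to_inf a k2 b2)
        (\<lambda>w. \<chi> i. ((\<lambda>z. Y z $ i) \<circ> n) w) \<gamma> (\<sigma> (homotopy_class (- m ` D) \<gamma>))"
      if \<gamma>: "\<gamma> \<in> loops (- m ` D) (m x)" for \<gamma>
    proof -
      have n\<gamma>: "n \<circ> \<gamma> \<in> loops (- D) x"
        using loops_compose[OF \<gamma> cont(2) img(2)] by (simp add: inv)
      \<comment> \<open>Every loop in the image is the m-image of a loop around D, to which the
        transfer of monodromy matrices applies.\<close>
      have "m \<circ> (n \<circ> \<gamma>) = \<gamma>"
        by (simp add: fun_eq_iff inv)
      then show ?thesis
        using monodromy_matrix_transfer[OF _ mono[OF n\<gamma>]] n\<gamma>
        by (simp add: loops_def \<sigma>_def induced_map_homotopy_class[OF \<gamma> cont(2) img(2)])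
    qed
    then have "monodromy_representation (m ` D) (coeff1_to_inf a k1 b1) (coeff2_to_inf a k2 b2) (m x) \<sigma>"
      using solution_basis_transfer[OF assms(3) Y] unfolding monodromy_representation_def by blast
    moreover have "m x \<notin> m ` D"
      using assms(3) inv by (metis imageE)
    ultimately obtain q where q: "riemann_sturm_liouville_equation (m ` D) q"
      "monodromy_representation (m ` D) (\<lambda>_. 0) q (m x) \<sigma>"
      using reduce[OF mD \<open>b' \<noteq> c'\<close> _ \<sigma> k(1)] by blast
    have "moebius_transformation m"
      unfolding moebius_transformation_def m_def to_inf_moebius
      by (intro exI[of _ 0] exI[of _ 1] exI[of _ 1] exI[of _ "- a"]) auto
    moreover have "\<rho> A = \<sigma> (induced_map m (- m ` D) A)" if A: "A \<in> carrier (fundamental_group (- D) x)" for A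
    proof -
      obtain p where p: "p \<in> loops (- D) x" "A = homotopy_class (- D) p"
        using A by (auto simp: fundamental_group_def)
      have "n \<circ> (m \<circ> p) = p"
        by (simp add: fun_eq_iff inv)
      then show ?thesis
        unfolding \<sigma>_def p(2) induced_map_homotopy_class[OF p(1) cont(1) img(1)]
          induced_map_homotopy_class[OF loops_compose[OF p(1) cont(1) img(1)] cont(2) img(2)] by simp
    qed
    ultimately show ?thesis
      using q \<sigma> by (intro exI[of _ m] exI[of _ q] exI[of _ \<sigma>]) (auto simp: mD)
  qed
qed

end
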